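(* Let $S$ be a finite nonempty set and, for $i=1,2$, let $B_i$ be the integral base-polyhedron defined by an integer-valued supermodular function $p_i$, with $\dot B_i=B_i\cap\mathbb{Z}^S$ and linear extension $\hat p_i$. For an integer vector $c\in\mathbb{Z}^S$ with $c(s)\ge1$ for all $s\in S$, $$\min\Big\{\sum_{s\in S}c(s)x(s)^2 : x\in\dot B_1\cap\dot B_2\Big\}=\max\Big\{\hat p_1(\pi_1)+\hat p_2(\pi_2)-\sum_{s\in S}\Big\lfloor\tfrac12\Big(\tfrac{\pi(s)}{c(s)}+1\Big)\Big\rfloor\Big(\pi(s)-c(s)\Big\lfloor\tfrac12\Big(\tfrac{\pi(s)}{c(s)}+1\Big)\Big\rfloor\Big) : \pi=\pi_1+\pi_2,\ \pi_1,\pi_2\in\mathbb{Z}^S\Big\},$$ where the minimum over the empty set is $+\infty$ and the maximum is understood as a supremum.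
   Context: An integral base-polyhedron defined by an integer-valued supermodular $p:2^S\to\mathbb{Z}\cup\{-\infty\}$ with $p(\emptyset)=0$, $p(S)$ finite (supermodular: $p(X)+p(Y)\le p(X\cap Y)+p(X\cup Y)$ when the left terms are finite) is $B=\{x\in\mathbb{R}^S:\widetilde x(S)=p(S),\ \widetilde x(Z)\ge p(Z)\ \forall Z\subset S\}$, $\widetilde x(Z)=\sum_{v\in Z}x(v)$, assumed nonempty. The linear (Lovász) extension is $\hat p(\pi)=p(I_n)\pi(s_n)+\sum_{j=1}^{n-1}p(I_j)[\pi(s_j)-\pi(s_{j+1})]$, where $n=|S|$, $\pi(s_1)\ge\dots\ge\pi(s_n)$, $I_j=\{s_1,\dots,s_j\}$; for supermodular $p$ it equals $\min\{\langle\pi,x\rangle:x\in B\cap\mathbb{Z}^S\}$ (possibly $-\infty$). *)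

theory Defs
  imports Complex_Main "HOL-Library.Extended_Real" "HOL-Library.FuncSet"
    "HOL-Library.Multiset"
begin

text \<open>A vector indexed by \<open>S\<close> is an extensional function: \<open>S \<rightarrow>\<^sub>E UNIV\<close> plays the role of
  \<open>R^S\<close> and \<open>S \<rightarrow>\<^sub>E \<int>\<close> that of \<open>Z^S\<close>. Set functions take values in
  \<^typ>\<open>ereal\<close>, of which only the integers and \<open>-\<infinity>\<close> are used; their values outside
  the subsets of \<open>S\<close> are irrelevant.\<close>

definition int_vecs :: "'a set \<Rightarrow> ('a \<Rightarrow> real) set" where
  "int_vecs S = S \<rightarrow>\<^sub>E \<int>"

definition int_supermodular :: "'a set \<Rightarrow> ('a set \<Rightarrow> ereal) \<Rightarrow> bool" where
  "int_supermodular S p \<longleftrightarrow>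
     (\<forall>X\<subseteq>S. p X = -\<infinity> \<or> (\<exists>k::int. p X = ereal (of_int k))) \<and>
     p {} = 0 \<and> p S \<noteq> -\<infinity> \<and>
     (\<forall>X\<subseteq>S. \<forall>Y\<subseteq>S. p X \<noteq> -\<infinity> \<longrightarrow> p Y \<noteq> -\<infinity> \<longrightarrow> p X + p Y \<le> p (X \<inter> Y) + p (X \<union> Y))"

definition base_polyhedron :: "'a set \<Rightarrow> ('a set \<Rightarrow> ereal) \<Rightarrow> ('a \<Rightarrow> real) set" where
  "base_polyhedron S p =
     {x \<in> S \<rightarrow>\<^sub>E UNIV. ereal (\<Sum>v\<in>S. x v) = p S \<and> (\<forall>Z\<subseteq>S. p Z \<le> ereal (\<Sum>v\<in>Z. x v))}"

definition int_base_points :: "'a set \<Rightarrow> ('a set \<Rightarrow> ereal) \<Rightarrow> ('a \<Rightarrow> real) set" where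
  "int_base_points S p = base_polyhedron S p \<inter> int_vecs S"

definition decreasing_ordering :: "'a set \<Rightarrow> ('a \<Rightarrow> real) \<Rightarrow> 'a list \<Rightarrow> bool" where
  "decreasing_ordering S \<pi> ss \<longleftrightarrow>
     distinct ss \<and> set ss = S \<and> sorted_wrt (\<lambda>s t. \<pi> s \<ge> \<pi> t) ss"

text \<open>Lists are indexed from 0, so \<open>ss ! (j - 1)\<close> is \<open>s\<^sub>j\<close>. A term with
  \<open>\<pi>(s\<^sub>j) = \<pi>(s\<^sub>j\<^sub>+\<^sub>1)\<close> vanishes even if \<open>p(I\<^sub>j) = -\<infinity>\<close>, because \<open>-\<infinity> * 0 = 0\<close> in
  \<^typ>\<open>ereal\<close>; this is what makes the value independent of how ties are broken
  (lemma \<open>lin_ext_eq\<close>).\<close>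

definition lin_ext_along :: "('a set \<Rightarrow> ereal) \<Rightarrow> ('a \<Rightarrow> real) \<Rightarrow> 'a list \<Rightarrow> ereal" where
  "lin_ext_along p \<pi> ss =
     p (set ss) * ereal (\<pi> (last ss)) +
     (\<Sum>j=1..length ss - 1. p (set (take j ss)) * ereal (\<pi> (ss ! (j - 1)) - \<pi> (ss ! j)))"

definition lin_ext :: "'a set \<Rightarrow> ('a set \<Rightarrow> ereal) \<Rightarrow> ('a \<Rightarrow> real) \<Rightarrow> ereal" where
  "lin_ext S p \<pi> = lin_ext_along p \<pi> (SOME ss. decreasing_ordering S \<pi> ss)"

lemma decreasing_ordering_exists:
  assumes "finite S"
  shows "\<exists>ss. decreasing_ordering S \<pi> ss"
proof -
  obtain xs where xs: "set xs = S" "distinct xs"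
    using finite_distinct_list[OF assms] by blast
  define ss where "ss = sort_key (\<lambda>s. - \<pi> s) xs"
  have "sorted (map (\<lambda>s. - \<pi> s) ss)"
    by (simp add: ss_def)
  hence "decreasing_ordering S \<pi> ss"
    using xs by (simp add: decreasing_ordering_def ss_def sorted_wrt_map)
  thus ?thesis ..
qed

lemma prefix_eq_level_set:
  assumes "decreasing_ordering S \<pi> ss" "0 < j" "j < length ss" "\<pi> (ss ! (j - 1)) \<noteq> \<pi> (ss ! j)"
  shows "set (take j ss) = {s \<in> S. \<pi> s > \<pi> (ss ! j)}"
proof -
  have mono: "\<pi> (ss ! k) \<le> \<pi> (ss ! i)" if "i \<le> k" "k < length ss" for i k
    using assms(1) that sorted_wrt_nth_less[of "\<lambda>s t. \<pi> s \<ge> \<pi> t" ss i k]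
    by (cases "i = k") (auto simp: decreasing_ordering_def)
  have gap: "\<pi> (ss ! (j - 1)) > \<pi> (ss ! j)"
    using mono[of "j - 1" j] assms by auto
  have iff: "i < j \<longleftrightarrow> \<pi> (ss ! i) > \<pi> (ss ! j)" if i: "i < length ss" for i
  proof (cases "i < j")
    case True
    hence "i \<le> j - 1" "j - 1 < length ss" using assms(3) by auto
    hence "\<pi> (ss ! (j - 1)) \<le> \<pi> (ss ! i)" by (rule mono)
    thus ?thesis using True gap by simp
  next
    case False
    thus ?thesis using mono[of j i] i by auto
  qed
  have "set ss = S" using assms(1) by (simp add: decreasing_ordering_def)
  moreover have "set (take j ss) = {ss ! i | i. i < j}"
    using assms(3) by (auto simp flip: nth_image)
  moreover have "{ss ! i | i. i < j} = {s \<in> set ss. \<pi> s > \<pi> (ss ! j)}"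
    unfolding in_set_conv_nth using iff assms(3) by (safe; metis order.strict_trans)
  ultimately show ?thesis by simp
qed

lemma decreasing_ordering_values_eq:
  assumes "decreasing_ordering S \<pi> ss" "decreasing_ordering S \<pi> ts"
  shows "map \<pi> ss = map \<pi> ts"
proof -
  have "mset ss = mset ts"
    using assms by (auto simp: decreasing_ordering_def set_eq_iff_mset_eq_distinct)
  hence "mset (map (\<lambda>s. - \<pi> s) ss) = mset (map (\<lambda>s. - \<pi> s) ts)"
    by simp
  moreover have "sorted (map (\<lambda>s. - \<pi> s) ss)" "sorted (map (\<lambda>s. - \<pi> s) ts)"
    using assms by (simp_all add: decreasing_ordering_def sorted_wrt_map)
  ultimately have "map (\<lambda>s. - \<pi> s) ss = map (\<lambda>s. - \<pi> s) ts"
    by (metis properties_for_sort)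
  hence "map uminus (map (\<lambda>s. - \<pi> s) ss) = map uminus (map (\<lambda>s. - \<pi> s) ts)"
    by (rule arg_cong)
  thus ?thesis by (simp add: comp_def)
qed

lemma lin_ext_along_unique:
  assumes ss: "decreasing_ordering S \<pi> ss" and ts: "decreasing_ordering S \<pi> ts" and "S \<noteq> {}"
  shows "lin_ext_along p \<pi> ss = lin_ext_along p \<pi> ts"
proof -
  have vals: "map \<pi> ss = map \<pi> ts"
    by (rule decreasing_ordering_values_eq[OF ss ts])
  have len: "length ss = length ts"
    using vals by (rule map_eq_imp_length_eq)
  have nth: "\<pi> (ss ! i) = \<pi> (ts ! i)" if "i < length ss" for i
    using that len vals by (metis nth_map)
  have sets: "set ss = S" "set ts = S"
    using ss ts by (auto simp: decreasing_ordering_def)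
  have ne: "ss \<noteq> []" "ts \<noteq> []" using sets \<open>S \<noteq> {}\<close> by auto
  have last: "\<pi> (last ss) = \<pi> (last ts)"
    using ne len nth by (simp add: last_conv_nth)
  have "p (set (take j ss)) * ereal (\<pi> (ss ! (j - 1)) - \<pi> (ss ! j)) =
        p (set (take j ts)) * ereal (\<pi> (ts ! (j - 1)) - \<pi> (ts ! j))"
    if "j \<in> {1..length ss - 1}" for j
  proof -
    have j: "0 < j" "j < length ss" using that by auto
    have eq: "\<pi> (ss ! (j - 1)) = \<pi> (ts ! (j - 1))" "\<pi> (ss ! j) = \<pi> (ts ! j)"
      using j nth by auto
    show ?thesis
    proof (cases "\<pi> (ss ! (j - 1)) = \<pi> (ss ! j)")
      case True
      thus ?thesis using eq by (simp flip: zero_ereal_def)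
    next
      case False
      thus ?thesis
        using prefix_eq_level_set[OF ss j] prefix_eq_level_set[OF ts, of j] j len eq by simp
    qed
  qed
  thus ?thesis
    unfolding lin_ext_along_def using sets last len by simp
qed

lemma lin_ext_eq:
  assumes "finite S" "S \<noteq> {}" "decreasing_ordering S \<pi> ss"
  shows "lin_ext S p \<pi> = lin_ext_along p \<pi> ss"
  unfolding lin_ext_def
  by (rule lin_ext_along_unique[OF someI_ex[OF decreasing_ordering_exists[OF assms(1)]] assms(3,2)])

end

theory Submission
  imports Defs
begin

text \<open>On integer vectors the linear extension is a sum of \<open>p\<close> over level sets, so it is supermodular
  on the lattice \<open>Z\<^sup>S\<close> and changes by \<open>k p(S)\<close> under translation by the constant \<open>k\<close>. Every integral
  dual value is an integer or \<open>-\<infinity>\<close>, so a bounded dual is attained, at \<open>(\<pi>\<^sub>1, \<pi>\<^sub>2)\<close> say. Comparing it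
  with \<open>(\<pi>\<^sub>1 + \<chi>\<^sub>X, \<pi>\<^sub>2 - \<chi>\<^sub>Y)\<close> for all \<open>X, Y\<close> gives the hypothesis of a discrete separation theorem
  with box constraints, which is proved by eliminating one coordinate at a time. The separating integer
  vector \<open>x\<close> is a local and therefore global supergradient of both linear extensions, which puts it in both
  bases; the box, whose sides are the difference quotients of the conjugate of \<open>c x\<^sup>2\<close>, makes all
  inequalities of weak duality tight. If the dual is unbounded, weak duality excludes primal points.\<close>

section \<open>Discrete separation with box constraints\<close>

definition int_or_minf :: "ereal \<Rightarrow> bool" where
  "int_or_minf x \<longleftrightarrow> x = -\<infinity> \<or> (\<exists>k::int. x = ereal (of_int k))"

lemma int_or_minf_cases:
  assumes "int_or_minf x"
  obtains "x = -\<infinity>" | k :: int where "x = ereal (of_int k)"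
  using assms by (auto simp: int_or_minf_def)

lemma int_or_minf_of_int [simp]: "int_or_minf (ereal (of_int k))"
  by (auto simp: int_or_minf_def)

lemma int_or_minf_0 [simp]: "int_or_minf 0"
  using int_or_minf_of_int[of 0] by (simp add: zero_ereal_def)

lemma int_or_minf_add:
  assumes "int_or_minf x" "int_or_minf y"
  shows "int_or_minf (x + y)"
  using assms(1)
proof (cases rule: int_or_minf_cases)
  case 1
  thus ?thesis using assms(2) by (auto simp: int_or_minf_def)
next
  case (2 k)
  show ?thesis using assms(2)
  proof (cases rule: int_or_minf_cases)
    case (2 j)
    thus ?thesis using \<open>x = ereal (of_int k)\<close> int_or_minf_of_int[of "k + j"] by simp
  qed (use 2 in \<open>auto simp: int_or_minf_def\<close>)
qed

lemma int_or_minf_diff: "int_or_minf x \<Longrightarrow> int_or_minf (x - ereal (of_int k))"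
  using int_or_minf_add[OF _ int_or_minf_of_int[of "- k"], of x] by (simp add: minus_ereal_def)

lemma int_or_minf_max: "int_or_minf x \<Longrightarrow> int_or_minf y \<Longrightarrow> int_or_minf (max x y)"
  by (simp add: max_def)

lemma int_or_minf_sum: "(\<And>i. i \<in> A \<Longrightarrow> int_or_minf (f i)) \<Longrightarrow> int_or_minf (sum f A)"
  by (induction A rule: infinite_finite_induct) (auto intro: int_or_minf_add)

text \<open>For \<open>l \<le> u\<close> and \<open>X\<close>, \<open>Y\<close> inside
  \<open>S\<close> this is the support function of the box \<open>[l, u]\<close> at the difference
  of the indicators of \<open>X\<close> and \<open>Y\<close>: the maximum of x(X) - x(Y) over the
  box.\<close>

definition box_support :: "('a \<Rightarrow> int) \<Rightarrow> ('a \<Rightarrow> int) \<Rightarrow> 'a set \<Rightarrow> 'a set \<Rightarrow> 'a set \<Rightarrow> int" where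
  "box_support l u S X Y =
     (\<Sum>v\<in>S. if v \<in> X \<and> v \<notin> Y then u v else if v \<in> Y \<and> v \<notin> X then - l v else 0)"

text \<open>Holds coordinatewise, with equality except where one pair counts \<open>v\<close>
  positively and the other negatively; there it reads \<open>0 \<le> u v - l v\<close>.\<close>

lemma box_support_submodular:
  assumes "\<And>v. v \<in> S \<Longrightarrow> l v \<le> u v"
  shows "box_support l u S (X \<inter> X') (Y \<inter> Y') + box_support l u S (X \<union> X') (Y \<union> Y')
         \<le> box_support l u S X Y + box_support l u S X' Y'"
  unfolding box_support_def sum.distrib[symmetric]
  by (rule sum_mono) (use assms in auto)

lemma box_support_insert:
  assumes "finite S" "s \<notin> S" "X \<subseteq> S" "Y \<subseteq> S"
  shows "box_support l u (insert s S) X Y = box_support l u S X Y"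
    and "box_support l u (insert s S) (insert s X) (insert s Y) = box_support l u S X Y"
    and "box_support l u (insert s S) (insert s X) Y = u s + box_support l u S X Y"
    and "box_support l u (insert s S) X (insert s Y) = - l s + box_support l u S X Y"
proof -
  have "v \<noteq> s" if "v \<in> S" for v using that assms by auto
  moreover have "s \<notin> X" "s \<notin> Y" using assms by auto
  ultimately show "box_support l u (insert s S) X Y = box_support l u S X Y"
    "box_support l u (insert s S) (insert s X) (insert s Y) = box_support l u S X Y"
    "box_support l u (insert s S) (insert s X) Y = u s + box_support l u S X Y"
    "box_support l u (insert s S) X (insert s Y) = - l s + box_support l u S X Y"
    using assms by (auto simp: box_support_def intro!: sum.cong)
qed

text \<open>With \<open>a = - \<alpha>\<close> these maxima define the section of the base polyhedron at \<open>x(s) = \<alpha>\<close>.\<close>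

lemma max_contract_supermodular:
  fixes p :: "'a set \<Rightarrow> ereal"
  assumes p: "\<And>X Y. X \<subseteq> insert s S \<Longrightarrow> Y \<subseteq> insert s S \<Longrightarrow> p X + p Y \<le> p (X \<inter> Y) + p (X \<union> Y)"
    and "s \<notin> S" "X \<subseteq> S" "Y \<subseteq> S"
  shows "max (p X) (p (insert s X) + ereal a) + max (p Y) (p (insert s Y) + ereal a)
    \<le> max (p (X \<inter> Y)) (p (insert s (X \<inter> Y)) + ereal a) + max (p (X \<union> Y)) (p (insert s (X \<union> Y)) + ereal a)"
    (is "?L \<le> ?I + ?U")
proof -
  have sets: "X \<inter> insert s Y = X \<inter> Y" "insert s X \<inter> Y = X \<inter> Y"
    "X \<union> insert s Y = insert s (X \<union> Y)" "insert s X \<union> Y = insert s (X \<union> Y)"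
    "insert s X \<inter> insert s Y = insert s (X \<inter> Y)" "insert s X \<union> insert s Y = insert s (X \<union> Y)"
    using assms(2-4) by auto
  have sub: "X \<subseteq> insert s S" "Y \<subseteq> insert s S" "insert s X \<subseteq> insert s S" "insert s Y \<subseteq> insert s S"
    using assms by auto
  \<comment> \<open>Each maximum on the left equals one of its two arguments, which leaves four
    cases, each an instance of supermodularity.\<close>
  have "p X + p Y \<le> p (X \<inter> Y) + p (X \<union> Y)" by (intro p sub)
  also have "\<dots> \<le> ?I + ?U" by (intro add_mono) auto
  finally have 1: "p X + p Y \<le> ?I + ?U" .
  have "p X + (p (insert s Y) + ereal a) \<le> (p (X \<inter> Y) + p (insert s (X \<union> Y))) + ereal a"
    using p[OF sub(1,4)] sets by (simp add: add.assoc[symmetric] add_right_mono)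
  also have "\<dots> = p (X \<inter> Y) + (p (insert s (X \<union> Y)) + ereal a)" by (simp add: add.assoc)
  also have "\<dots> \<le> ?I + ?U" by (intro add_mono) auto
  finally have 2: "p X + (p (insert s Y) + ereal a) \<le> ?I + ?U" .
  have "(p (insert s X) + ereal a) + p Y = (p (insert s X) + p Y) + ereal a" by (simp add: ac_simps)
  also have "\<dots> \<le> (p (X \<inter> Y) + p (insert s (X \<union> Y))) + ereal a"
    using p[OF sub(3,2)] sets by (simp add: add_right_mono)
  also have "\<dots> = p (X \<inter> Y) + (p (insert s (X \<union> Y)) + ereal a)" by (simp add: add.assoc)
  also have "\<dots> \<le> ?I + ?U" by (intro add_mono) auto
  finally have 3: "(p (insert s X) + ereal a) + p Y \<le> ?I + ?U" .
  have "(p (insert s X) + ereal a) + (p (insert s Y) + ereal a) = (p (insert s X) + p (insert s Y)) + (ereal a + ereal a)"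
    by (simp only: ac_simps)
  also have "\<dots> \<le> (p (insert s (X \<inter> Y)) + p (insert s (X \<union> Y))) + (ereal a + ereal a)"
    using p[OF sub(3,4)] sets by (simp add: add_right_mono)
  also have "\<dots> = (p (insert s (X \<inter> Y)) + ereal a) + (p (insert s (X \<union> Y)) + ereal a)"
    by (simp only: ac_simps)
  also have "\<dots> \<le> ?I + ?U" by (intro add_mono) auto
  finally have 4: "(p (insert s X) + ereal a) + (p (insert s Y) + ereal a) \<le> ?I + ?U" .
  show ?thesis using 1 2 3 4 unfolding max_def[of "p X"] max_def[of "p Y"] by auto
qed

lemma ereal_add_le_cancel:
  "ereal a + ereal b + z \<le> ereal b + ereal c \<Longrightarrow> ereal a + z \<le> ereal c"
  by (cases z) auto

text \<open>A discrete sandwich theorem with bounds: \<open>x\<close> lies above the supermodular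
  \<open>p\<close> and below the submodular \<open>- n\<close>. Adding the constraints for
  \<open>X\<close> and \<open>Y\<close> shows that the last hypothesis is necessary. For
  sufficiency, a Fourier-Motzkin step fixes one coordinate at an integer and passes to the section
  there. The form \<open>0 \<le> p {}\<close> is inherited by the maxima that define the
  section.\<close>

lemma supermodular_box_separation:
  fixes p n :: "'a set \<Rightarrow> ereal" and l u :: "'a \<Rightarrow> int"
  assumes "finite S"
    and "\<And>X. X \<subseteq> S \<Longrightarrow> int_or_minf (p X)" and "\<And>X. X \<subseteq> S \<Longrightarrow> int_or_minf (n X)"
    and "\<And>X Y. X \<subseteq> S \<Longrightarrow> Y \<subseteq> S \<Longrightarrow> p X + p Y \<le> p (X \<inter> Y) + p (X \<union> Y)"
    and "\<And>X Y. X \<subseteq> S \<Longrightarrow> Y \<subseteq> S \<Longrightarrow> n X + n Y \<le> n (X \<inter> Y) + n (X \<union> Y)"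
    and "0 \<le> p {}" and "0 \<le> n {}"
    and "\<And>v. v \<in> S \<Longrightarrow> l v \<le> u v"
    and "\<And>X Y. X \<subseteq> S \<Longrightarrow> Y \<subseteq> S \<Longrightarrow> p X + n Y \<le> ereal (of_int (box_support l u S X Y))"
  shows "\<exists>x :: 'a \<Rightarrow> int. (\<forall>v\<in>S. l v \<le> x v \<and> x v \<le> u v) \<and>
    (\<forall>X\<subseteq>S. p X \<le> ereal (of_int (sum x X)) \<and> n X \<le> ereal (of_int (- sum x X)))"
  using assms
proof (induction S arbitrary: p n rule: finite_induct)
  case empty
  have "p {} + n {} \<le> 0"
    using empty(8)[of "{}" "{}"] by (simp add: box_support_def zero_ereal_def)
  hence "p {} \<le> 0" "n {} \<le> 0"
    using empty(5,6) add_left_mono[of 0 "n {}" "p {}"] add_right_mono[of 0 "p {}" "n {}"]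
    by (auto intro: order_trans)
  thus ?case by (simp add: zero_ereal_def)
next
  case (insert s S)
  note pint = insert.prems(1) and nint = insert.prems(2) and psup = insert.prems(3)
    and nsup = insert.prems(4) and p0 = insert.prems(5) and n0 = insert.prems(6)
    and lu = insert.prems(7) and gap = insert.prems(8)
  let ?w = "box_support l u S"
  \<comment> \<open>The constraints at \<open>insert s X\<close> and \<open>Y\<close> require
    \<open>p (insert s X) + n Y\<close> to be at most x(s) + x(X) - x(Y), hence at most
    \<open>x s + ?w X Y\<close>. So \<open>?g\<close> lists lower bounds on \<open>x s\<close>, and
    \<open>\<alpha>\<close> will be the largest of these and \<open>l s\<close>; it is an integer
    because \<open>l s\<close> is finite.\<close>
  let ?g = "\<lambda>(X, Y). p (insert s X) + n Y - ereal (of_int (?w X Y))"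
  define A where "A = insert (ereal (of_int (l s))) (?g ` (Pow S \<times> Pow S))"
  have fin: "finite A" "A \<noteq> {}" using insert.hyps by (auto simp: A_def)
  have sub: "X \<subseteq> insert s S" "insert s X \<subseteq> insert s S" if "X \<subseteq> S" for X using that by auto
  have A_int: "int_or_minf z" if "z \<in> A" for z
    using that pint nint sub
    by (auto simp: A_def intro!: int_or_minf_diff int_or_minf_add)
  have "ereal (of_int (l s)) \<le> Max A" using fin by (auto simp: A_def)
  moreover have "int_or_minf (Max A)" using A_int Max_in[OF fin] by auto
  ultimately obtain \<alpha> :: int where \<alpha>: "Max A = ereal (of_int \<alpha>)"
    by (auto simp: int_or_minf_def)
  have l_le: "l s \<le> \<alpha>" using \<open>ereal (of_int (l s)) \<le> Max A\<close> \<alpha> by simp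
  have lower: "p (insert s X) + n Y \<le> ereal (of_int \<alpha>) + ereal (of_int (?w X Y))"
    if "X \<subseteq> S" "Y \<subseteq> S" for X Y
  proof -
    have "?g (X, Y) \<in> A" unfolding A_def using that by blast
    hence "?g (X, Y) \<le> ereal (of_int \<alpha>)" using Max_ge[OF fin(1) \<open>?g (X, Y) \<in> A\<close>] \<alpha> by simp
    thus ?thesis by (simp add: ereal_minus_le)
  qed
  \<comment> \<open>The constraints at \<open>X'\<close> and \<open>insert s Y'\<close> bound
    \<open>x s\<close> from above. The value \<open>\<alpha>\<close> respects them because it is
    \<open>l s\<close> or comes from a pair that can be uncrossed with this one.\<close>
  have upper: "ereal (of_int \<alpha>) + (p X' + n (insert s Y')) \<le> ereal (of_int (?w X' Y'))"
    if X': "X' \<subseteq> S" and Y': "Y' \<subseteq> S" for X' Y'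
  proof -
    have "ereal (of_int \<alpha>) \<in> A" using Max_in[OF fin] \<alpha> by simp
    then consider "\<alpha> = l s" | X Y where "X \<subseteq> S" "Y \<subseteq> S" "ereal (of_int \<alpha>) = ?g (X, Y)"
      by (auto simp: A_def)
    thus ?thesis
    proof cases
      case 1
      have "p X' + n (insert s Y') \<le> ereal (of_int (- l s + ?w X' Y'))"
        using gap[OF sub(1)[OF X'] sub(2)[OF Y']] box_support_insert[OF insert.hyps X' Y'] by simp
      thus ?thesis using 1 add_left_mono[of _ _ "ereal (of_int \<alpha>)"] by fastforce
    next
      case 2
      note X = 2(1) and Y = 2(2)
      have sets: "insert s X \<inter> X' = X \<inter> X'" "insert s X \<union> X' = insert s (X \<union> X')"
        "Y \<inter> insert s Y' = Y \<inter> Y'" "Y \<union> insert s Y' = insert s (Y \<union> Y')"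
        using X Y X' Y' insert.hyps by auto
      have sub2: "X \<inter> X' \<subseteq> S" "X \<union> X' \<subseteq> S" "Y \<inter> Y' \<subseteq> S" "Y \<union> Y' \<subseteq> S"
        using X X' Y Y' by auto
      have eq: "p (insert s X) + n Y = ereal (of_int \<alpha>) + ereal (of_int (?w X Y))"
        using 2(3) by (cases "p (insert s X) + n Y") auto
      \<comment> \<open>After uncrossing, \<open>s\<close> lies in neither intersection and in both
        unions, so it adds nothing to the box support and \<open>gap\<close> applies to both
        pairs.\<close>
      have "ereal (of_int \<alpha>) + ereal (of_int (?w X Y)) + (p X' + n (insert s Y'))
          = (p (insert s X) + p X') + (n Y + n (insert s Y'))"
        unfolding eq[symmetric] by (simp only: ac_simps)
      also have "\<dots> \<le> (p (X \<inter> X') + p (insert s (X \<union> X'))) + (n (Y \<inter> Y') + n (insert s (Y \<union> Y')))"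
        by (rule add_mono) (use psup[of "insert s X" X'] nsup[of Y "insert s Y'"] X Y X' Y' sub sets in auto)
      also have "\<dots> = (p (X \<inter> X') + n (Y \<inter> Y')) + (p (insert s (X \<union> X')) + n (insert s (Y \<union> Y')))"
        by (simp only: ac_simps)
      also have "\<dots> \<le> ereal (of_int (?w (X \<inter> X') (Y \<inter> Y'))) + ereal (of_int (?w (X \<union> X') (Y \<union> Y')))"
        by (rule add_mono)
          (use gap[OF sub(1)[OF sub2(1)] sub(1)[OF sub2(3)]]
            gap[OF sub(2)[OF sub2(2)] sub(2)[OF sub2(4)]]
            box_support_insert[OF insert.hyps sub2(1,3)] box_support_insert[OF insert.hyps sub2(2,4)]
           in auto)
      also have "\<dots> \<le> ereal (of_int (?w X Y)) + ereal (of_int (?w X' Y'))"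
      proof -
        have "?w (X \<inter> X') (Y \<inter> Y') + ?w (X \<union> X') (Y \<union> Y') \<le> ?w X Y + ?w X' Y'"
          by (rule box_support_submodular) (use lu in auto)
        thus ?thesis by (simp flip: of_int_add)
      qed
      finally show ?thesis
        by (rule ereal_add_le_cancel)
    qed
  qed
  have le_u: "\<alpha> \<le> u s"
  proof -
    have "ereal (of_int \<alpha>) \<in> A" using Max_in[OF fin] \<alpha> by simp
    then consider "\<alpha> = l s" | X Y where "X \<subseteq> S" "Y \<subseteq> S" "ereal (of_int \<alpha>) = ?g (X, Y)"
      by (auto simp: A_def)
    thus ?thesis
    proof cases
      case 1
      thus ?thesis using lu by auto
    next
      case 2
      have "p (insert s X) + n Y \<le> ereal (of_int (u s + ?w X Y))"
        using gap[of "insert s X" Y] sub 2 box_support_insert[OF insert.hyps 2(1,2)] by simp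
      thus ?thesis using 2(3) by (cases "p (insert s X) + n Y") auto
    qed
  qed
  \<comment> \<open>The sections at \<open>x s = \<alpha>\<close>; the sign is opposite in
    \<open>n'\<close> because \<open>n\<close> bounds \<open>- x\<close>.\<close>
  define p' where "p' X = max (p X) (p (insert s X) + ereal (- of_int \<alpha>))" for X
  define n' where "n' X = max (n X) (n (insert s X) + ereal (of_int \<alpha>))" for X
  have "\<exists>x :: 'a \<Rightarrow> int. (\<forall>v\<in>S. l v \<le> x v \<and> x v \<le> u v) \<and>
    (\<forall>X\<subseteq>S. p' X \<le> ereal (of_int (sum x X)) \<and> n' X \<le> ereal (of_int (- sum x X)))"
  proof (rule insert.IH)
    show "int_or_minf (p' X)" "int_or_minf (n' X)" if "X \<subseteq> S" for X
      using that pint nint sub int_or_minf_of_int[of \<alpha>] int_or_minf_of_int[of "- \<alpha>"]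
      unfolding p'_def n'_def by (auto intro!: int_or_minf_max int_or_minf_add)
    show "p' X + p' Y \<le> p' (X \<inter> Y) + p' (X \<union> Y)" "n' X + n' Y \<le> n' (X \<inter> Y) + n' (X \<union> Y)"
      if "X \<subseteq> S" "Y \<subseteq> S" for X Y
      using max_contract_supermodular[OF psup insert.hyps(2) that]
        max_contract_supermodular[OF nsup insert.hyps(2) that]
      by (auto simp: p'_def n'_def)
    show "0 \<le> p' {}" "0 \<le> n' {}" using p0 n0 by (auto simp: p'_def n'_def le_max_iff_disj)
    show "l v \<le> u v" if "v \<in> S" for v using lu that by auto
    fix X Y assume X: "X \<subseteq> S" and Y: "Y \<subseteq> S"
    \<comment> \<open>The element \<open>s\<close> may join neither set, both sets, only
      \<open>X\<close> or only \<open>Y\<close>. In the first two cases it cancels; the last two are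
      exactly \<open>lower\<close> and \<open>upper\<close>.\<close>
    have 1: "p X + n Y \<le> ereal (of_int (?w X Y))"
      using gap[of X Y] X Y sub box_support_insert[OF insert.hyps X Y] by simp
    have "p (insert s X) + n (insert s Y) \<le> ereal (of_int (?w X Y))"
      using gap[of "insert s X" "insert s Y"] X Y sub box_support_insert[OF insert.hyps X Y] by simp
    hence 2: "(p (insert s X) + ereal (- of_int \<alpha>)) + (n (insert s Y) + ereal (of_int \<alpha>))
        \<le> ereal (of_int (?w X Y))"
      by (cases "p (insert s X)"; cases "n (insert s Y)") auto
    have 3: "(p (insert s X) + ereal (- of_int \<alpha>)) + n Y \<le> ereal (of_int (?w X Y))"
      using lower[OF X Y] by (cases "p (insert s X)"; cases "n Y") auto
    have 4: "p X + (n (insert s Y) + ereal (of_int \<alpha>)) \<le> ereal (of_int (?w X Y))"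
      using upper[OF X Y] by (simp add: ac_simps)
    show "p' X + n' Y \<le> ereal (of_int (?w X Y))"
      using 1 2 3 4 unfolding p'_def n'_def max_def by auto
  qed
  then obtain x :: "'a \<Rightarrow> int" where x: "\<And>v. v \<in> S \<Longrightarrow> l v \<le> x v \<and> x v \<le> u v"
    and px: "\<And>X. X \<subseteq> S \<Longrightarrow> p' X \<le> ereal (of_int (sum x X))"
    and nx: "\<And>X. X \<subseteq> S \<Longrightarrow> n' X \<le> ereal (of_int (- sum x X))"
    by blast
  define y where "y = x(s := \<alpha>)"
  have y_box: "l v \<le> y v \<and> y v \<le> u v" if "v \<in> insert s S" for v
    using that x l_le le_u by (auto simp: y_def)
  have "p X \<le> ereal (of_int (sum y X)) \<and> n X \<le> ereal (of_int (- sum y X))"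
    if X: "X \<subseteq> insert s S" for X
  proof (cases "s \<in> X")
    case False
    hence "X \<subseteq> S" using X by auto
    moreover have "sum y X = sum x X" using False by (auto simp: y_def intro!: sum.cong)
    ultimately show ?thesis using px[of X] nx[of X] by (auto simp: p'_def n'_def)
  next
    case True
    define Z where "Z = X - {s}"
    have Z: "Z \<subseteq> S" "X = insert s Z" "s \<notin> Z" using True X by (auto simp: Z_def)
    have "finite Z" using Z insert.hyps by (auto intro: finite_subset)
    hence "sum y X = \<alpha> + sum y Z" using Z by (simp add: y_def)
    moreover have "sum y Z = sum x Z" using Z by (auto simp: y_def intro!: sum.cong)
    ultimately have sy: "sum y X = \<alpha> + sum x Z" by simp
    have "p X + ereal (- of_int \<alpha>) \<le> ereal (of_int (sum x Z))"
      "n X + ereal (of_int \<alpha>) \<le> ereal (of_int (- sum x Z))"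
      using px[OF Z(1)] nx[OF Z(1)] Z(2) by (auto simp: p'_def n'_def)
    thus ?thesis unfolding sy by (cases "p X"; cases "n X") auto
  qed
  with y_box show ?case by blast
qed

section \<open>The linear extension on integer vectors\<close>

text \<open>The empty interval is covered because \<open>z * 0 = 0\<close> in \<open>ereal\<close>
  even for infinite \<open>z\<close>, in agreement with the vanishing of tied terms in
  \<open>lin_ext_along\<close>.\<close>

lemma sum_const_ereal: "(\<Sum>t\<in>{m<..M::int}. z :: ereal) = z * ereal (real_of_int (M - m))" if "m \<le> M"
proof -
  have "(\<Sum>t\<in>A. z) = z * ereal (real (card A))" if "finite A" for A :: "int set"
    using that
  proof (induction A rule: finite_induct)
    case (insert x A)
    have "z + z * ereal (real (card A)) = z * ereal (1 + real (card A))"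
      by (cases z) (auto simp: algebra_simps)
    thus ?case using insert by simp
  qed (simp flip: zero_ereal_def)
  from this[of "{m<..M}"] show ?thesis using that by simp
qed

text \<open>Integer vectors are handled below as total functions, so their values outside
  \<open>S\<close> have to be irrelevant.\<close>

lemma lin_ext_cong:
  assumes "finite S" "S \<noteq> {}" and eq: "\<And>v. v \<in> S \<Longrightarrow> \<pi> v = \<rho> v"
  shows "lin_ext S p \<pi> = lin_ext S p \<rho>"
proof -
  obtain ss where ss: "decreasing_ordering S \<pi> ss"
    using decreasing_ordering_exists[OF assms(1)] by blast
  have set: "set ss = S" and "ss \<noteq> []"
    using ss assms(2) by (auto simp: decreasing_ordering_def)
  have "decreasing_ordering S \<rho> ss"
    using ss eq unfolding decreasing_ordering_def
    by (auto intro: sorted_wrt_mono_rel[of ss "\<lambda>s t. \<pi> s \<ge> \<pi> t"])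
  moreover have "\<pi> (last ss) = \<rho> (last ss)" using eq set \<open>ss \<noteq> []\<close> by auto
  moreover have "\<pi> (ss ! i) = \<rho> (ss ! i)" if "i < length ss" for i
    using eq nth_mem[OF that] set by auto
  ultimately show ?thesis
    unfolding lin_ext_eq[OF assms(1,2) ss] lin_ext_eq[OF assms(1,2) \<open>decreasing_ordering S \<rho> ss\<close>]
      lin_ext_along_def
    by (auto intro!: sum.cong arg_cong2[of _ _ _ _ "(+)"])
qed

locale supermodular_base =
  fixes S :: "'a set" and p :: "'a set \<Rightarrow> ereal"
  assumes fin [simp]: "finite S" and nonempty: "S \<noteq> {}" and int_super: "int_supermodular S p"
begin

lemma int_valued: "X \<subseteq> S \<Longrightarrow> int_or_minf (p X)"
  using int_super unfolding int_supermodular_def int_or_minf_def by blast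

lemma empty_eq_0 [simp]: "p {} = 0"
  using int_super unfolding int_supermodular_def by blast

text \<open>No value is \<open>\<infinity>\<close>, so a left side with a term
  \<open>-\<infinity>\<close> is itself \<open>-\<infinity>\<close>.\<close>

lemma supermodular:
  assumes "X \<subseteq> S" "Y \<subseteq> S"
  shows "p X + p Y \<le> p (X \<inter> Y) + p (X \<union> Y)"
proof (cases "p X = -\<infinity> \<or> p Y = -\<infinity>")
  case True
  moreover have "p X \<noteq> \<infinity>" "p Y \<noteq> \<infinity>"
    using int_valued[OF assms(1)] int_valued[OF assms(2)] by (auto simp: int_or_minf_def)
  ultimately have eq: "p X + p Y = -\<infinity>" by (cases "p X"; cases "p Y") auto
  show ?thesis unfolding eq by simp
next
  case False
  thus ?thesis using int_super assms unfolding int_supermodular_def by blast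
qed

definition total :: int where "total = \<lfloor>real_of_ereal (p S)\<rfloor>"

lemma total: "p S = ereal (of_int total)"
proof -
  have "p S \<noteq> -\<infinity>" using int_super unfolding int_supermodular_def by blast
  thus ?thesis using int_valued[of S] by (auto simp: int_or_minf_def total_def)
qed

definition P :: "('a \<Rightarrow> int) \<Rightarrow> ereal" where "P \<pi> = lin_ext S p (\<lambda>v. of_int (\<pi> v))"

definition level :: "('a \<Rightarrow> int) \<Rightarrow> int \<Rightarrow> 'a set" where "level \<pi> t = {v\<in>S. t \<le> \<pi> v}"

lemma level_subset: "level \<pi> t \<subseteq> S" by (auto simp: level_def)

text \<open>A layer-cake formula: the difference of two consecutive values counts the integers
  between them, and all these share one level set, a prefix of the ordering. The bounds
  \<open>m\<close> and \<open>M\<close> are left free so that several vectors can be expanded over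
  the same range and compared term by term.\<close>

lemma P_levels:
  assumes bounds: "\<And>v. v \<in> S \<Longrightarrow> m \<le> \<pi> v \<and> \<pi> v \<le> M"
  shows "P \<pi> = ereal (of_int (m * total)) + (\<Sum>t\<in>{m<..M}. p (level \<pi> t))"
proof -
  obtain ss where ss: "decreasing_ordering S (\<lambda>v. real_of_int (\<pi> v)) ss"
    using decreasing_ordering_exists[OF fin] by blast
  have set_ss: "set ss = S" and ne: "ss \<noteq> []"
    using ss nonempty by (auto simp: decreasing_ordering_def)
  define a where "a j = \<pi> (ss ! j)" for j
  have mono: "a k \<le> a i" if "i \<le> k" "k < length ss" for i k
    using ss that sorted_wrt_nth_less[of "\<lambda>s t. real_of_int (\<pi> s) \<ge> real_of_int (\<pi> t)" ss i k]
    by (cases "i = k") (auto simp: decreasing_ordering_def a_def)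
  have a_bounds: "m \<le> a k \<and> a k \<le> M" if "k < length ss" for k
    using bounds[of "ss ! k"] that set_ss nth_mem[OF that] by (simp add: a_def)
  \<comment> \<open>The threshold descends along the ordering. Passing from \<open>a k\<close> to
    \<open>a (Suc k)\<close> adds levels whose common level set is the prefix of length
    \<open>Suc k\<close>, since positions start at 0.\<close>
  have telescope: "(\<Sum>t\<in>{a k<..M}. p (level \<pi> t)) =
      (\<Sum>j=1..k. p (set (take j ss)) * ereal (of_int (\<pi> (ss ! (j - 1))) - of_int (\<pi> (ss ! j))))"
    if "k < length ss" for k
    using that
  proof (induction k)
    case 0
    have "\<not> t \<le> \<pi> v" if t: "t \<in> {a 0<..M}" and v: "v \<in> S" for t v
    proof -
      obtain i where "i < length ss" "v = ss ! i" using v unfolding set_ss[symmetric] in_set_conv_nth by blast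
      thus ?thesis using mono[of 0 i] t by (simp add: a_def)
    qed
    hence "level \<pi> t = {}" if "t \<in> {a 0<..M}" for t
      using that by (auto simp: level_def)
    thus ?case by simp
  next
    case (Suc k)
    have step: "a (Suc k) \<le> a k" using mono[of k "Suc k"] Suc.prems by simp
    have lev: "level \<pi> t = set (take (Suc k) ss)" if t: "t \<in> {a (Suc k)<..a k}" for t
    proof -
      have iff: "t \<le> \<pi> (ss ! i) \<longleftrightarrow> i < Suc k" if "i < length ss" for i
        using mono[of i k] mono[of "Suc k" i] that Suc.prems t by (cases "i < Suc k") (auto simp: a_def)
      have "{v\<in>set ss. t \<le> \<pi> v} = (!) ss ` {0..<Suc k}"
      proof (intro set_eqI iffI)
        fix v assume "v \<in> {v\<in>set ss. t \<le> \<pi> v}"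
        then obtain i where "i < length ss" "v = ss ! i" "t \<le> \<pi> v"
          by (auto simp: in_set_conv_nth)
        thus "v \<in> (!) ss ` {0..<Suc k}" using iff[of i] by auto
      next
        fix v assume "v \<in> (!) ss ` {0..<Suc k}"
        then obtain i where i: "i < Suc k" "v = ss ! i" by auto
        moreover from i have "i < length ss" using Suc.prems by simp
        ultimately show "v \<in> {v\<in>set ss. t \<le> \<pi> v}" using iff[of i] by auto
      qed
      also have "\<dots> = set (take (Suc k) ss)"
        using Suc.prems by (intro nth_image) simp
      also have "{v\<in>set ss. t \<le> \<pi> v} = level \<pi> t" by (simp add: level_def set_ss)
      finally show ?thesis .
    qed
    have "{a (Suc k)<..M} = {a (Suc k)<..a k} \<union> {a k<..M}"
      using step a_bounds[of k] Suc.prems by auto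
    moreover have "(\<Sum>t\<in>{a (Suc k)<..a k} \<union> {a k<..M}. p (level \<pi> t)) =
      (\<Sum>t\<in>{a (Suc k)<..a k}. p (level \<pi> t)) + (\<Sum>t\<in>{a k<..M}. p (level \<pi> t))"
      by (rule sum.union_disjoint) auto
    moreover have "(\<Sum>t\<in>{a (Suc k)<..a k}. p (level \<pi> t)) =
        p (set (take (Suc k) ss)) * ereal (real_of_int (a k - a (Suc k)))"
      unfolding sum_const_ereal[OF step, symmetric] by (intro sum.cong refl arg_cong[of _ _ p] lev)
    ultimately show ?case using Suc.IH Suc.prems by (simp add: a_def ac_simps)
  qed
  \<comment> \<open>Up to the minimum \<open>b\<close> of \<open>\<pi>\<close> every level set is
    \<open>S\<close>; these levels raise the constant from \<open>m * total\<close> to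
    \<open>b * total\<close>, the leading term of the linear extension.\<close>
  define b where "b = a (length ss - 1)"
  have b: "m \<le> b" "b \<le> M" using a_bounds[of "length ss - 1"] ne by (auto simp: b_def)
  have b_le: "b \<le> \<pi> v" if v: "v \<in> S" for v
  proof -
    from v have "v \<in> set ss" by (simp only: set_ss)
    then obtain i where "i < length ss" "ss ! i = v" by (auto simp only: in_set_conv_nth)
    thus ?thesis using mono[of i "length ss - 1"] by (simp add: a_def b_def)
  qed
  have lev: "level \<pi> t = S" if t: "t \<in> {m<..b}" for t
    using b_le t by (force simp: level_def)
  have "(\<Sum>t\<in>{m<..M}. p (level \<pi> t)) = (\<Sum>t\<in>{m<..b} \<union> {b<..M}. p (level \<pi> t))"
    using b by (intro sum.cong) auto
  also have "\<dots> = (\<Sum>t\<in>{m<..b}. p (level \<pi> t)) + (\<Sum>t\<in>{b<..M}. p (level \<pi> t))"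
    by (rule sum.union_disjoint) auto
  also have "(\<Sum>t\<in>{m<..b}. p (level \<pi> t)) = (\<Sum>t\<in>{m<..b}. p S)"
    by (intro sum.cong refl arg_cong[of _ _ p] lev)
  also have "\<dots> = ereal (of_int (total * (b - m)))"
    using b by (simp add: sum_const_ereal total)
  finally have "ereal (of_int (m * total)) + (\<Sum>t\<in>{m<..M}. p (level \<pi> t)) =
      ereal (of_int (m * total)) + ereal (of_int (total * (b - m))) + (\<Sum>t\<in>{b<..M}. p (level \<pi> t))"
    by (simp only: add.assoc)
  also have "ereal (of_int (m * total)) + ereal (of_int (total * (b - m))) = p S * ereal (of_int b)"
    by (simp add: total algebra_simps)
  also have "b = \<pi> (last ss)" using ne by (simp add: b_def a_def last_conv_nth)
  also have "p S * ereal (of_int (\<pi> (last ss))) + (\<Sum>t\<in>{\<pi> (last ss)<..M}. p (level \<pi> t)) = P \<pi>"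
    using telescope[of "length ss - 1"] ne
    unfolding P_def lin_ext_eq[OF fin nonempty ss] lin_ext_along_def set_ss
    by (simp add: a_def last_conv_nth)
  finally show ?thesis by simp
qed

section \<open>Lattice, translation and duality properties of the extension\<close>

lemma bounds_exist:
  fixes F :: "('a \<Rightarrow> int) set"
  assumes "finite F"
  obtains m M where "\<And>\<pi> v. \<pi> \<in> F \<Longrightarrow> v \<in> S \<Longrightarrow> m \<le> \<pi> v \<and> \<pi> v \<le> M"
proof
  fix \<pi> v assume "\<pi> \<in> F" "v \<in> S"
  hence "\<pi> v \<in> (\<Union>\<rho>\<in>F. \<rho> ` S)" by auto
  thus "Min (\<Union>\<rho>\<in>F. \<rho> ` S) \<le> \<pi> v \<and> \<pi> v \<le> Max (\<Union>\<rho>\<in>F. \<rho> ` S)"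
    using assms by auto
qed

lemma P_cong: "(\<And>v. v \<in> S \<Longrightarrow> \<pi> v = \<rho> v) \<Longrightarrow> P \<pi> = P \<rho>"
  unfolding P_def by (rule lin_ext_cong[OF fin nonempty]) simp

lemma P_int_valued: "int_or_minf (P \<pi>)"
proof -
  obtain m M where "\<And>\<sigma> v. \<sigma> \<in> {\<pi>} \<Longrightarrow> v \<in> S \<Longrightarrow> m \<le> \<sigma> v \<and> \<sigma> v \<le> M"
    using bounds_exist[of "{\<pi>}"] by auto
  hence "P \<pi> = ereal (of_int (m * total)) + (\<Sum>t\<in>{m<..M}. p (level \<pi> t))"
    by (intro P_levels) auto
  thus ?thesis
    using int_or_minf_of_int int_or_minf_sum int_or_minf_add int_valued level_subset by metis
qed

text \<open>Level sets turn pointwise minima and maxima into intersections and unions, so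
  supermodularity of \<open>p\<close> applies at each level.\<close>

lemma P_supermodular:
  "P \<pi> + P \<rho> \<le> P (\<lambda>v. min (\<pi> v) (\<rho> v)) + P (\<lambda>v. max (\<pi> v) (\<rho> v))"
proof -
  obtain m M where b: "\<And>\<sigma> v. \<sigma> \<in> {\<pi>, \<rho>} \<Longrightarrow> v \<in> S \<Longrightarrow> m \<le> \<sigma> v \<and> \<sigma> v \<le> M"
    using bounds_exist[of "{\<pi>, \<rho>}"] by auto
  define c where "c = ereal (of_int (m * total))"
  have levels: "P \<sigma> = c + (\<Sum>t\<in>{m<..M}. p (level \<sigma> t))"
    if "\<sigma> \<in> {\<pi>, \<rho>, \<lambda>v. min (\<pi> v) (\<rho> v), \<lambda>v. max (\<pi> v) (\<rho> v)}" for \<sigma>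
    unfolding c_def
  proof (rule P_levels)
    fix v assume "v \<in> S"
    thus "m \<le> \<sigma> v \<and> \<sigma> v \<le> M" using b[of \<pi> v] b[of \<rho> v] that by auto
  qed
  have lev: "level (\<lambda>v. min (\<pi> v) (\<rho> v)) t = level \<pi> t \<inter> level \<rho> t"
    "level (\<lambda>v. max (\<pi> v) (\<rho> v)) t = level \<pi> t \<union> level \<rho> t" for t
    by (auto simp: level_def le_max_iff_disj)
  have "P \<pi> + P \<rho> = (c + c) + (\<Sum>t\<in>{m<..M}. p (level \<pi> t) + p (level \<rho> t))"
    by (simp add: levels sum.distrib ac_simps)
  also have "\<dots> \<le> (c + c) + (\<Sum>t\<in>{m<..M}. p (level \<pi> t \<inter> level \<rho> t) + p (level \<pi> t \<union> level \<rho> t))"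
    by (intro add_left_mono sum_mono supermodular level_subset)
  also have "\<dots> = P (\<lambda>v. min (\<pi> v) (\<rho> v)) + P (\<lambda>v. max (\<pi> v) (\<rho> v))"
    by (simp add: levels lev sum.distrib ac_simps)
  finally show ?thesis .
qed

lemma P_shift: "P (\<lambda>v. \<pi> v + k) = P \<pi> + ereal (of_int (k * total))"
proof -
  obtain m M where b: "\<And>\<sigma> v. \<sigma> \<in> {\<pi>} \<Longrightarrow> v \<in> S \<Longrightarrow> m \<le> \<sigma> v \<and> \<sigma> v \<le> M"
    using bounds_exist[of "{\<pi>}"] by auto
  have 1: "P \<pi> = ereal (of_int (m * total)) + (\<Sum>t\<in>{m<..M}. p (level \<pi> t))"
    using b by (intro P_levels) auto
  have 2: "P (\<lambda>v. \<pi> v + k) = ereal (of_int ((m + k) * total)) + (\<Sum>t\<in>{m + k<..M + k}. p (level (\<lambda>v. \<pi> v + k) t))"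
    using b by (intro P_levels) auto
  have "(\<Sum>t\<in>{m + k<..M + k}. p (level (\<lambda>v. \<pi> v + k) t)) = (\<Sum>t\<in>{m<..M}. p (level \<pi> t))"
    by (rule sum.reindex_bij_witness[of _ "\<lambda>t. t + k" "\<lambda>t. t - k"])
      (auto simp: level_def intro!: arg_cong[of _ _ p])
  moreover have "ereal (of_int ((m + k) * total)) = ereal (of_int (m * total)) + ereal (of_int (k * total))"
    by (simp add: algebra_simps)
  ultimately show ?thesis using 1 2 by (simp only: ac_simps)
qed

text \<open>Every level in \<open>{0<..k}\<close> is \<open>Z\<close>. These test vectors later
  recover the constraints of the base polyhedron from inequalities for \<open>P\<close>.\<close>

lemma P_scaled_indicator:
  assumes "Z \<subseteq> S" "0 \<le> k"
  shows "P (\<lambda>v. if v \<in> Z then k else 0) = p Z * ereal (of_int k)"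
proof -
  have "P (\<lambda>v. if v \<in> Z then k else 0) = ereal (of_int (0 * total)) +
      (\<Sum>t\<in>{0<..k}. p (level (\<lambda>v. if v \<in> Z then k else 0) t))"
    using assms by (intro P_levels) auto
  also have "(\<Sum>t\<in>{0<..k}. p (level (\<lambda>v. if v \<in> Z then k else 0) t)) = (\<Sum>t\<in>{0<..k}. p Z)"
    using assms by (intro sum.cong refl arg_cong[of _ _ p]) (auto simp: level_def)
  finally show ?thesis using sum_const_ereal[of 0 k "p Z"] assms by (simp flip: zero_ereal_def)
qed

lemma P_0: "P (\<lambda>v. 0) = 0"
  using P_scaled_indicator[of "{}" 0] by simp

text \<open>The easy half of the minimum formula: \<open>p\<close> is at most \<open>x\<close> on
  every level set, and the same layer-cake expansion for the modular function of \<open>x\<close>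
  gives the inner product.\<close>

lemma P_le_inner:
  assumes x: "(\<lambda>v\<in>S. real_of_int (x v)) \<in> base_polyhedron S p"
  shows "P \<pi> \<le> ereal (of_int (\<Sum>v\<in>S. \<pi> v * x v))"
proof -
  obtain m M where b: "\<And>\<sigma> v. \<sigma> \<in> {\<pi>} \<Longrightarrow> v \<in> S \<Longrightarrow> m \<le> \<sigma> v \<and> \<sigma> v \<le> M"
    using bounds_exist[of "{\<pi>}"] by auto
  have le: "p Z \<le> ereal (of_int (sum x Z))" if "Z \<subseteq> S" for Z
  proof -
    have "(\<Sum>v\<in>Z. (\<lambda>v\<in>S. real_of_int (x v)) v) = of_int (sum x Z)"
      unfolding of_int_sum using that by (intro sum.cong) auto
    moreover have "p Z \<le> ereal (sum (\<lambda>v\<in>S. real_of_int (x v)) Z)"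
      using x that unfolding base_polyhedron_def by blast
    ultimately show ?thesis by simp
  qed
  have tot: "total = sum x S"
    using x total unfolding base_polyhedron_def by (simp flip: of_int_sum)
  have "P \<pi> = ereal (of_int (m * total)) + (\<Sum>t\<in>{m<..M}. p (level \<pi> t))"
    using b by (intro P_levels) auto
  also have "\<dots> \<le> ereal (of_int (m * total)) + (\<Sum>t\<in>{m<..M}. ereal (of_int (sum x (level \<pi> t))))"
    by (intro add_left_mono sum_mono le level_subset)
  also have "\<dots> = ereal (of_int (m * sum x S + (\<Sum>t\<in>{m<..M}. sum x (level \<pi> t))))"
    by (simp add: tot)
  also have "(\<Sum>t\<in>{m<..M}. sum x (level \<pi> t)) = (\<Sum>v\<in>S. \<Sum>t | t \<in> {m<..M} \<and> t \<le> \<pi> v. x v)"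
    unfolding level_def by (rule sum.swap_restrict) auto
  also have "\<dots> = (\<Sum>v\<in>S. (\<pi> v - m) * x v)"
  proof (rule sum.cong)
    fix v assume "v \<in> S"
    hence "m \<le> \<pi> v" "\<pi> v \<le> M" using b by auto
    moreover from this have "{t. t \<in> {m<..M} \<and> t \<le> \<pi> v} = {m<..\<pi> v}" by auto
    ultimately show "(\<Sum>t | t \<in> {m<..M} \<and> t \<le> \<pi> v. x v) = (\<pi> v - m) * x v" by simp
  qed simp
  also have "m * sum x S + \<dots> = (\<Sum>v\<in>S. \<pi> v * x v)"
    by (simp add: sum_distrib_left left_diff_distrib sum_subtractf)
  finally show ?thesis .
qed

text \<open>If \<open>\<pi> \<le> \<rho> \<le> \<pi> + k + 1\<close>, the meet of \<open>\<rho>\<close> with \<open>\<pi> + k\<close> is at most \<open>\<pi> + k\<close>, and their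
  join is \<open>\<pi> + k\<close> plus the indicator of a set, where the local hypothesis applies.\<close>

lemma supergradient_global:
  assumes fin_\<pi>: "P \<pi> = ereal (of_int q)" and tot: "sum x S = total"
    and loc: "\<And>X. X \<subseteq> S \<Longrightarrow> P (\<lambda>v. \<pi> v + of_bool (v \<in> X)) \<le> P \<pi> + ereal (of_int (sum x X))"
  shows "P \<rho> \<le> P \<pi> + ereal (of_int (\<Sum>v\<in>S. (\<rho> v - \<pi> v) * x v))"
proof -
  have main: "P \<rho> \<le> P \<pi> + ereal (of_int (\<Sum>v\<in>S. (\<rho> v - \<pi> v) * x v))"
    if "\<And>v. v \<in> S \<Longrightarrow> \<pi> v \<le> \<rho> v \<and> \<rho> v \<le> \<pi> v + int k" for \<rho> k
    using that
  proof (induction k arbitrary: \<rho>)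
    case 0
    hence eq: "\<rho> v = \<pi> v" if "v \<in> S" for v using that by force
    have "P \<rho> = P \<pi>" by (rule P_cong) (rule eq)
    thus ?case by (simp add: eq cong: sum.cong)
  next
    case (Suc k)
    define \<tau> where "\<tau> v = min (\<rho> v) (\<pi> v + int k)" for v
    define X where "X = {v\<in>S. \<rho> v = \<pi> v + int (Suc k)}"
    have X: "X \<subseteq> S" by (auto simp: X_def)
    have \<tau>: "P \<tau> \<le> P \<pi> + ereal (of_int (\<Sum>v\<in>S. (\<tau> v - \<pi> v) * x v))"
      using Suc.prems by (intro Suc.IH) (auto simp: \<tau>_def)
    have "P (\<lambda>v. max (\<rho> v) (\<pi> v + int k)) = P (\<lambda>v. (\<pi> v + of_bool (v \<in> X)) + int k)"
    proof (rule P_cong)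
      fix v assume "v \<in> S"
      thus "max (\<rho> v) (\<pi> v + int k) = \<pi> v + of_bool (v \<in> X) + int k"
        using Suc.prems[of v] by (auto simp: X_def)
    qed
    also have "\<dots> = P (\<lambda>v. \<pi> v + of_bool (v \<in> X)) + ereal (of_int (int k * total))"
      by (rule P_shift)
    also have "\<dots> \<le> P \<pi> + ereal (of_int (sum x X)) + ereal (of_int (int k * total))"
      by (intro add_right_mono loc X)
    finally have join: "P (\<lambda>v. max (\<rho> v) (\<pi> v + int k)) \<le> ereal (of_int (q + sum x X + int k * total))"
      by (simp add: fin_\<pi> add.assoc)
    \<comment> \<open>Supermodularity for \<open>\<rho>\<close> and the translate of
      \<open>\<pi>\<close> by \<open>k\<close>. The value at the translate is finite and can be
      cancelled.\<close>
    have "P \<rho> + ereal (of_int (q + int k * total)) = P \<rho> + P (\<lambda>v. \<pi> v + int k)"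
      by (simp add: P_shift fin_\<pi>)
    also have "\<dots> \<le> P \<tau> + P (\<lambda>v. max (\<rho> v) (\<pi> v + int k))"
      unfolding \<tau>_def by (rule P_supermodular)
    also have "\<dots> \<le> (P \<pi> + ereal (of_int (\<Sum>v\<in>S. (\<tau> v - \<pi> v) * x v))) +
        ereal (of_int (q + sum x X + int k * total))"
      by (intro add_mono \<tau> join)
    finally have "P \<rho> \<le> ereal (of_int (q + ((\<Sum>v\<in>S. (\<tau> v - \<pi> v) * x v) + sum x X)))"
      by (cases "P \<rho>") (auto simp: fin_\<pi>)
    also have "sum x X = (\<Sum>v\<in>S. of_bool (v \<in> X) * x v)"
      using X by (simp add: of_bool_def if_distrib[of "\<lambda>t. t * _"] Int_absorb1 flip: sum.inter_restrict cong: if_cong)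
    also have "(\<Sum>v\<in>S. (\<tau> v - \<pi> v) * x v) + \<dots> = (\<Sum>v\<in>S. (\<rho> v - \<pi> v) * x v)"
      unfolding sum.distrib[symmetric]
    proof (rule sum.cong)
      fix v assume "v \<in> S"
      hence "\<tau> v + of_bool (v \<in> X) = \<rho> v" using Suc.prems[of v] by (auto simp: \<tau>_def X_def)
      thus "(\<tau> v - \<pi> v) * x v + of_bool (v \<in> X) * x v = (\<rho> v - \<pi> v) * x v"
        by (auto simp: algebra_simps simp flip: \<open>\<tau> v + of_bool (v \<in> X) = \<rho> v\<close>)
    qed simp
    finally show ?case by (simp add: fin_\<pi>)
  qed
  obtain m M where b: "\<And>\<sigma> v. \<sigma> \<in> {\<pi>, \<rho>} \<Longrightarrow> v \<in> S \<Longrightarrow> m \<le> \<sigma> v \<and> \<sigma> v \<le> M"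
    using bounds_exist[of "{\<pi>, \<rho>}"] by auto
  \<comment> \<open>Raising \<open>\<rho>\<close> by \<open>M - m\<close> puts it above
    \<open>\<pi>\<close>, by at most \<open>2 * (M - m)\<close>. Since x(S) is \<open>total\<close>,
    both sides change by the same amount.\<close>
  have "P (\<lambda>v. \<rho> v + (M - m)) \<le> P \<pi> + ereal (of_int (\<Sum>v\<in>S. (\<rho> v + (M - m) - \<pi> v) * x v))"
  proof (rule main[of _ "nat (2 * (M - m))"])
    fix v assume "v \<in> S"
    thus "\<pi> v \<le> \<rho> v + (M - m) \<and> \<rho> v + (M - m) \<le> \<pi> v + int (nat (2 * (M - m)))"
      using b[of \<pi> v] b[of \<rho> v] by auto
  qed
  also have "(\<Sum>v\<in>S. (\<rho> v + (M - m) - \<pi> v) * x v) = (\<Sum>v\<in>S. (\<rho> v - \<pi> v) * x v) + (M - m) * total"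
    by (simp add: tot[symmetric] sum_distrib_left flip: sum.distrib) (simp add: algebra_simps)
  finally show ?thesis
    unfolding P_shift fin_\<pi> by (cases "P \<rho>") (auto simp: algebra_simps)
qed

text \<open>The global inequality is evaluated at 0 and at multiples of indicators. \<open>P\<close>
  is linear along such multiples, so a violated constraint at \<open>Z\<close> would eventually
  outgrow the constant slack.\<close>

lemma supergradient_in_base:
  assumes fin_\<pi>: "P \<pi> = ereal (of_int q)" and tot: "sum x S = total"
    and loc: "\<And>X. X \<subseteq> S \<Longrightarrow> P (\<lambda>v. \<pi> v + of_bool (v \<in> X)) \<le> P \<pi> + ereal (of_int (sum x X))"
  shows "(\<lambda>v\<in>S. real_of_int (x v)) \<in> base_polyhedron S p"
    and "(\<Sum>v\<in>S. \<pi> v * x v) \<le> q"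
proof -
  note glob = supergradient_global[OF fin_\<pi> tot loc]
  have "P (\<lambda>v. 0) \<le> P \<pi> + ereal (of_int (\<Sum>v\<in>S. (0 - \<pi> v) * x v))" by (rule glob)
  thus "(\<Sum>v\<in>S. \<pi> v * x v) \<le> q" by (simp add: P_0 fin_\<pi> sum_negf zero_ereal_def flip: of_int_mult of_int_sum)
  have "p Z \<le> ereal (of_int (sum x Z))" if Z: "Z \<subseteq> S" for Z
  proof (cases "p Z = -\<infinity>")
    case False
    then obtain z :: int where z: "p Z = ereal (of_int z)"
      using int_valued[OF Z] by (auto simp: int_or_minf_def)
    have scaled: "z * k \<le> q - (\<Sum>v\<in>S. \<pi> v * x v) + k * sum x Z" if "0 \<le> k" for k
    proof -
      have "(\<Sum>v\<in>S. ((if v \<in> Z then k else 0) - \<pi> v) * x v) =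
          (\<Sum>v\<in>S. if v \<in> Z then k * x v else 0) - (\<Sum>v\<in>S. \<pi> v * x v)"
        unfolding sum_subtractf[symmetric] by (intro sum.cong) (auto simp: algebra_simps)
      also have "(\<Sum>v\<in>S. if v \<in> Z then k * x v else 0) = k * sum x Z"
        using Z by (simp add: Int_absorb1 sum_distrib_left flip: sum.inter_restrict)
      finally have "ereal (of_int (z * k)) \<le> ereal (of_int (q + (k * sum x Z - (\<Sum>v\<in>S. \<pi> v * x v))))"
        using glob[of "\<lambda>v. if v \<in> Z then k else 0"] P_scaled_indicator[OF Z that]
        by (simp add: fin_\<pi> z)
      hence "z * k \<le> q + (k * sum x Z - (\<Sum>v\<in>S. \<pi> v * x v))"
        unfolding ereal_less_eq of_int_le_iff .
      thus ?thesis by simp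
    qed
    have "z \<le> sum x Z"
    proof (rule ccontr)
      assume "\<not> z \<le> sum x Z"
      \<comment> \<open>Here \<open>d\<close> is the slack of the supergradient inequality at 0; the
        multiple \<open>\<bar>d\<bar> + 1\<close> already exceeds it.\<close>
      define d where "d = q - (\<Sum>v\<in>S. \<pi> v * x v)"
      have "(z - sum x Z) * (\<bar>d\<bar> + 1) \<le> d"
        using scaled[of "\<bar>d\<bar> + 1"] by (simp add: d_def algebra_simps)
      moreover have "1 * (\<bar>d\<bar> + 1) \<le> (z - sum x Z) * (\<bar>d\<bar> + 1)"
        using \<open>\<not> z \<le> sum x Z\<close> by (intro mult_right_mono) auto
      ultimately have "1 * (\<bar>d\<bar> + 1) \<le> d" by (rule order_trans[rotated])
      thus False by simp
    qed
    thus ?thesis unfolding z by (simp del: of_int_sum)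
  qed simp
  moreover have "(\<Sum>v\<in>Z. (\<lambda>v\<in>S. real_of_int (x v)) v) = of_int (sum x Z)" if "Z \<subseteq> S" for Z
    unfolding of_int_sum using that by (intro sum.cong) auto
  moreover from this[of S] have "ereal (\<Sum>v\<in>S. (\<lambda>v\<in>S. real_of_int (x v)) v) = p S"
    using total tot by simp
  ultimately show "(\<lambda>v\<in>S. real_of_int (x v)) \<in> base_polyhedron S p"
    unfolding base_polyhedron_def by (simp del: of_int_sum restrict_apply restrict_apply')
qed

end

section \<open>The conjugate of a weighted square\<close>

text \<open>\<open>conj_arg c a\<close> is the largest integer \<open>k\<close> maximizing \<open>k a - c k\<^sup>2\<close>.\<close>

definition conj_arg :: "int \<Rightarrow> int \<Rightarrow> int" where
  "conj_arg c a = (a + c) div (2 * c)"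

text \<open>The discrete conjugate of \<open>c k\<^sup>2\<close>, that is the maximum of
  \<open>k a - c k\<^sup>2\<close> over integers \<open>k\<close> when \<open>c \<ge> 1\<close>,
  written through its maximizer.\<close>

definition square_conj :: "int \<Rightarrow> int \<Rightarrow> int" where
  "square_conj c a = conj_arg c a * (a - c * conj_arg c a)"

text \<open>Local optimality: the maximizer is at least as good as its predecessor and strictly
  better than its successor.\<close>

lemma conj_arg_bounds:
  assumes "c \<ge> 1"
  shows "c * (2 * conj_arg c a - 1) \<le> a" "a < c * (2 * conj_arg c a + 1)"
proof -
  have "(2 * c) * conj_arg c a + (a + c) mod (2 * c) = a + c"
    unfolding conj_arg_def by (rule mult_div_mod_eq)
  moreover have "0 \<le> (a + c) mod (2 * c)" "(a + c) mod (2 * c) < 2 * c"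
    using assms by auto
  ultimately show "c * (2 * conj_arg c a - 1) \<le> a" "a < c * (2 * conj_arg c a + 1)"
    by (auto simp: algebra_simps)
qed

lemma conj_arg_mono: "c \<ge> 1 \<Longrightarrow> a \<le> b \<Longrightarrow> conj_arg c a \<le> conj_arg c b"
  by (simp add: conj_arg_def zdiv_mono1)

text \<open>The maximizer moves by at most one, and it moves only when \<open>a + 1\<close> is the
  breakpoint at which the old and the new maximizer tie.\<close>

lemma conj_arg_Suc_cases:
  assumes "c \<ge> 1"
  obtains "conj_arg c (a + 1) = conj_arg c a"
  | "conj_arg c (a + 1) = conj_arg c a + 1" "a + 1 = c * (2 * conj_arg c a + 1)"
proof (cases "a + 1 < c * (2 * conj_arg c a + 1)")
  case True
  let ?j = "conj_arg c (a + 1)"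
  have "c * (2 * ?j - 1) < c * (2 * conj_arg c a + 1)"
    using conj_arg_bounds(1)[OF assms, of "a + 1"] True by linarith
  hence "?j < conj_arg c a + 1" using assms by (simp add: mult_less_cancel_left)
  moreover have "conj_arg c a \<le> ?j" using assms by (intro conj_arg_mono) auto
  ultimately show ?thesis using that(1) by linarith
next
  case False
  hence eq: "a + 1 = c * (2 * conj_arg c a + 1)"
    using conj_arg_bounds(2)[OF assms, of a] by linarith
  hence "a + 1 + c = (2 * c) * (conj_arg c a + 1)" by (simp add: algebra_simps)
  hence "conj_arg c (a + 1) = conj_arg c a + 1"
    unfolding conj_arg_def[of c "a + 1"] using assms by simp
  thus ?thesis using that(2) eq by blast
qed

text \<open>The conjugate is piecewise linear with integer breakpoints, so its slope on a unit
  interval is the largest maximizer at the left end. This is the source of the box in the separation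
  argument.\<close>

lemma square_conj_diff:
  assumes "c \<ge> 1"
  shows "square_conj c (a + 1) = square_conj c a + conj_arg c a"
  using assms
proof (cases rule: conj_arg_Suc_cases[of c a])
  case 1
  thus ?thesis by (simp add: square_conj_def algebra_simps)
next
  case 2
  define k where "k = conj_arg c a"
  have a: "a = c * (2 * k + 1) - 1" using 2 by (simp add: k_def)
  show ?thesis unfolding square_conj_def 2(1) k_def[symmetric] unfolding a by (simp add: algebra_simps)
qed

lemma square_conj_ge:
  assumes "c \<ge> 1"
  shows "k * a - c * k\<^sup>2 \<le> square_conj c a"
proof -
  define j where "j = conj_arg c a"
  have b: "c * (2 * j - 1) \<le> a" "a < c * (2 * j + 1)"
    using conj_arg_bounds[OF assms, of a] by (auto simp: j_def)
  \<comment> \<open>This product is the difference of the two sides; local optimality of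
    \<open>j\<close> gives its factors compatible signs.\<close>
  have "0 \<le> (j - k) * (a - c * (j + k))"
  proof (cases "k < j")
    case True
    hence "c * (j + k) \<le> c * (2 * j - 1)" using assms by (intro mult_left_mono) auto
    thus ?thesis using True b by (intro mult_nonneg_nonneg) auto
  next
    case False
    show ?thesis
    proof (cases "k = j")
      case False
      hence "c * (2 * j + 1) \<le> c * (j + k)" using \<open>\<not> k < j\<close> assms by (intro mult_left_mono) auto
      thus ?thesis using \<open>\<not> k < j\<close> b by (intro mult_nonpos_nonpos) auto
    qed simp
  qed
  thus ?thesis by (simp add: square_conj_def j_def[symmetric] power2_eq_square algebra_simps)
qed

text \<open>Equality in the Fenchel inequality for \<open>x\<close> between the left and right
  slopes at \<open>a\<close>. They differ by at most one, so \<open>x\<close> is one of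
  them.\<close>

lemma square_conj_eq:
  assumes "c \<ge> 1" "conj_arg c (a - 1) \<le> x" "x \<le> conj_arg c a"
  shows "square_conj c a = x * a - c * x\<^sup>2"
proof -
  have "conj_arg c a \<le> conj_arg c (a - 1) + 1"
    using conj_arg_Suc_cases[OF assms(1), of "a - 1"] by fastforce
  then consider "x = conj_arg c a" | "x = conj_arg c (a - 1)" using assms by linarith
  thus ?thesis
  proof cases
    case 1
    thus ?thesis by (simp add: square_conj_def power2_eq_square algebra_simps)
  next
    case 2
    have "square_conj c a = square_conj c (a - 1) + x"
      using square_conj_diff[OF assms(1), of "a - 1"] 2 by simp
    thus ?thesis using 2 by (simp add: square_conj_def power2_eq_square algebra_simps)
  qed
qed

section \<open>Duality\<close>

lemma ereal_diff_add_le: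
  "a + b \<le> c + d \<Longrightarrow> (a - ereal q) + (b - ereal q) \<le> (c - ereal q) + (d - ereal q)"
proof -
  assume "a + b \<le> c + d"
  hence "(a + b) + (ereal (-q) + ereal (-q)) \<le> (c + d) + (ereal (-q) + ereal (-q))"
    by (rule add_right_mono)
  thus ?thesis by (simp only: minus_ereal_def uminus_ereal.simps ac_simps)
qed

locale two_bases = A: supermodular_base S p1 + B: supermodular_base S p2
  for S :: "'a set" and p1 p2 +
  fixes c :: "'a \<Rightarrow> int"
  assumes c_pos: "v \<in> S \<Longrightarrow> c v \<ge> 1"
begin

definition dual :: "('a \<Rightarrow> int) \<Rightarrow> ('a \<Rightarrow> int) \<Rightarrow> ereal" where
  "dual \<pi>1 \<pi>2 = A.P \<pi>1 + B.P \<pi>2 - ereal (of_int (\<Sum>v\<in>S. square_conj (c v) (\<pi>1 v + \<pi>2 v)))"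

lemma weak_duality:
  assumes "(\<lambda>v\<in>S. real_of_int (x v)) \<in> base_polyhedron S p1"
    and "(\<lambda>v\<in>S. real_of_int (x v)) \<in> base_polyhedron S p2"
  shows "dual \<pi>1 \<pi>2 \<le> ereal (of_int (\<Sum>v\<in>S. c v * (x v)\<^sup>2))"
proof -
  let ?H = "\<Sum>v\<in>S. square_conj (c v) (\<pi>1 v + \<pi>2 v)"
  let ?I1 = "\<Sum>v\<in>S. \<pi>1 v * x v" and ?I2 = "\<Sum>v\<in>S. \<pi>2 v * x v"
  have "A.P \<pi>1 + B.P \<pi>2 \<le> ereal (of_int ?I1) + ereal (of_int ?I2)"
    by (intro add_mono A.P_le_inner B.P_le_inner assms)
  hence "dual \<pi>1 \<pi>2 \<le> ereal (of_int ?I1) + ereal (of_int ?I2) - ereal (of_int ?H)"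
    unfolding dual_def by (rule ereal_minus_mono) simp
  also have "\<dots> = ereal (of_int (?I1 + ?I2 - ?H))" by simp
  also have "?I1 + ?I2 - ?H \<le> (\<Sum>v\<in>S. c v * (x v)\<^sup>2)"
  proof -
    have "?I1 + ?I2 - ?H = (\<Sum>v\<in>S. \<pi>1 v * x v + \<pi>2 v * x v - square_conj (c v) (\<pi>1 v + \<pi>2 v))"
      by (simp add: sum.distrib sum_subtractf)
    also have "\<dots> \<le> (\<Sum>v\<in>S. c v * (x v)\<^sup>2)"
    proof (rule sum_mono)
      fix v assume "v \<in> S"
      from square_conj_ge[OF c_pos[OF this], of "x v" "\<pi>1 v + \<pi>2 v"]
      show "\<pi>1 v * x v + \<pi>2 v * x v - square_conj (c v) (\<pi>1 v + \<pi>2 v) \<le> c v * (x v)\<^sup>2"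
        by (simp add: algebra_simps)
    qed
    finally show ?thesis .
  qed
  finally show ?thesis by (simp del: of_int_sum)
qed

lemma dual_int_valued: "int_or_minf (dual \<pi>1 \<pi>2)"
  unfolding dual_def by (intro int_or_minf_diff int_or_minf_add A.P_int_valued B.P_int_valued)

lemma dual_0: "dual (\<lambda>v. 0) (\<lambda>v. 0) = 0"
proof -
  have "square_conj (c v) 0 = 0" if "v \<in> S" for v
    using square_conj_eq[OF c_pos[OF that], of 0 0] c_pos[OF that]
    by (simp add: conj_arg_def div_neg_pos_less0 div_pos_pos_trivial)
  thus ?thesis by (simp add: dual_def A.P_0 B.P_0 zero_ereal_def[symmetric] cong: sum.cong)
qed

text \<open>The value 0 occurs at the zero vectors, so only integer values in \<open>{0..K}\<close>
  compete for the maximum, and these are finitely many.\<close>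

lemma dual_attained:
  assumes bdd: "\<And>\<pi>1 \<pi>2. dual \<pi>1 \<pi>2 \<le> ereal (of_int K)"
  obtains \<pi>1 \<pi>2 q where "dual \<pi>1 \<pi>2 = ereal (of_int q)"
    and "\<And>\<rho>1 \<rho>2. dual \<rho>1 \<rho>2 \<le> ereal (of_int q)"
proof -
  define V where "V = {k \<in> {0..K}. \<exists>\<pi>1 \<pi>2. dual \<pi>1 \<pi>2 = ereal (of_int k)}"
  have 0: "dual (\<lambda>v. 0) (\<lambda>v. 0) = ereal (of_int 0)" by (simp add: dual_0 zero_ereal_def)
  hence "0 \<in> V" using bdd[of "\<lambda>v. 0" "\<lambda>v. 0"] by (auto simp: V_def)
  moreover have "finite V" by (rule finite_subset[of _ "{0..K}"]) (auto simp: V_def)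
  ultimately have max: "Max V \<in> V" "\<And>k. k \<in> V \<Longrightarrow> k \<le> Max V" using Max_in by auto
  have "dual \<rho>1 \<rho>2 \<le> ereal (of_int (Max V))" for \<rho>1 \<rho>2
    using dual_int_valued[of \<rho>1 \<rho>2]
  proof (cases rule: int_or_minf_cases)
    case (2 k)
    have "k \<le> Max V"
    proof (cases "k \<ge> 0")
      case True
      thus ?thesis using 2 bdd[of \<rho>1 \<rho>2] by (intro max(2)) (auto simp: V_def)
    qed (use max(2)[OF \<open>0 \<in> V\<close>] in simp)
    thus ?thesis using 2 by simp
  qed simp
  with max(1) that show thesis by (auto simp: V_def)
qed

lemma strong_duality:
  assumes bdd: "\<And>\<pi>1 \<pi>2. dual \<pi>1 \<pi>2 \<le> ereal (of_int K)"
  obtains x \<pi>1 \<pi>2 where "(\<lambda>v\<in>S. real_of_int (x v)) \<in> base_polyhedron S p1"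
    and "(\<lambda>v\<in>S. real_of_int (x v)) \<in> base_polyhedron S p2"
    and "ereal (of_int (\<Sum>v\<in>S. c v * (x v)\<^sup>2)) \<le> dual \<pi>1 \<pi>2"
proof -
  obtain \<pi>1 \<pi>2 q where dq: "dual \<pi>1 \<pi>2 = ereal (of_int q)"
    and opt: "\<And>\<rho>1 \<rho>2. dual \<rho>1 \<rho>2 \<le> ereal (of_int q)"
    using dual_attained[OF bdd] by blast
  define H where "H \<rho>1 \<rho>2 = (\<Sum>v\<in>S. square_conj (c v) (\<rho>1 v + \<rho>2 v))" for \<rho>1 \<rho>2
  have dual_H: "dual \<rho>1 \<rho>2 = A.P \<rho>1 + B.P \<rho>2 - ereal (of_int (H \<rho>1 \<rho>2))" for \<rho>1 \<rho>2
    by (simp only: dual_def H_def)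
  obtain q1 q2 where q1: "A.P \<pi>1 = ereal (of_int q1)" and q2: "B.P \<pi>2 = ereal (of_int q2)"
    and q: "q = q1 + q2 - H \<pi>1 \<pi>2"
    using A.P_int_valued[of \<pi>1] B.P_int_valued[of \<pi>2] dq
    by (auto simp: dual_H int_or_minf_def simp flip: of_int_add of_int_diff)
  \<comment> \<open>The increments of the two extensions at the optimum, upwards for
    \<open>p1\<close> and downwards for \<open>p2\<close>. Moving downwards exchanges minima and
    maxima, which leaves \<open>n\<close> supermodular.\<close>
  define p where "p X = A.P (\<lambda>v. \<pi>1 v + of_bool (v \<in> X)) - ereal (of_int q1)" for X
  define n where "n X = B.P (\<lambda>v. \<pi>2 v - of_bool (v \<in> X)) - ereal (of_int q2)" for X
  define l where "l v = conj_arg (c v) (\<pi>1 v + \<pi>2 v - 1)" for v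
  define u where "u v = conj_arg (c v) (\<pi>1 v + \<pi>2 v)" for v
  have "\<exists>x :: 'a \<Rightarrow> int. (\<forall>v\<in>S. l v \<le> x v \<and> x v \<le> u v) \<and>
    (\<forall>X\<subseteq>S. p X \<le> ereal (of_int (sum x X)) \<and> n X \<le> ereal (of_int (- sum x X)))"
  proof (rule supermodular_box_separation)
    show "finite S" by simp
    show "int_or_minf (p X)" "int_or_minf (n X)" for X
      unfolding p_def n_def by (intro int_or_minf_diff A.P_int_valued B.P_int_valued)+
    show "p X + p Y \<le> p (X \<inter> Y) + p (X \<union> Y)" for X Y
    proof -
      have "(\<lambda>v. min (\<pi>1 v + of_bool (v \<in> X)) (\<pi>1 v + of_bool (v \<in> Y))) = (\<lambda>v. \<pi>1 v + of_bool (v \<in> X \<inter> Y))"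
        "(\<lambda>v. max (\<pi>1 v + of_bool (v \<in> X)) (\<pi>1 v + of_bool (v \<in> Y))) = (\<lambda>v. \<pi>1 v + of_bool (v \<in> X \<union> Y))"
        by auto
      thus ?thesis
        using A.P_supermodular[of "\<lambda>v. \<pi>1 v + of_bool (v \<in> X)" "\<lambda>v. \<pi>1 v + of_bool (v \<in> Y)"]
        unfolding p_def by (intro ereal_diff_add_le) simp
    qed
    show "n X + n Y \<le> n (X \<inter> Y) + n (X \<union> Y)" for X Y
    proof -
      have "(\<lambda>v. max (\<pi>2 v - of_bool (v \<in> X)) (\<pi>2 v - of_bool (v \<in> Y))) = (\<lambda>v. \<pi>2 v - of_bool (v \<in> X \<inter> Y))"
        "(\<lambda>v. min (\<pi>2 v - of_bool (v \<in> X)) (\<pi>2 v - of_bool (v \<in> Y))) = (\<lambda>v. \<pi>2 v - of_bool (v \<in> X \<union> Y))"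
        by auto
      thus ?thesis
        using B.P_supermodular[of "\<lambda>v. \<pi>2 v - of_bool (v \<in> X)" "\<lambda>v. \<pi>2 v - of_bool (v \<in> Y)"]
        unfolding n_def by (intro ereal_diff_add_le) (simp add: add.commute)
    qed
    show "0 \<le> p {}" "0 \<le> n {}" by (simp_all add: p_def n_def q1 q2)
    show "l v \<le> u v" if "v \<in> S" for v
      unfolding l_def u_def using c_pos[OF that] by (intro conj_arg_mono) auto
    show "p X + n Y \<le> ereal (of_int (box_support l u S X Y))" for X Y
    proof -
      let ?\<rho>1 = "\<lambda>v. \<pi>1 v + of_bool (v \<in> X)" and ?\<rho>2 = "\<lambda>v. \<pi>2 v - of_bool (v \<in> Y)"
      \<comment> \<open>A coordinate of the sum \<open>\<pi>1 + \<pi>2\<close> moves by one up, by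
        one down or not at all, and the conjugate changes by \<open>u v\<close>,
        \<open>- l v\<close> or 0. Thus the box condition is exactly optimality against this
        pair.\<close>
      have "H ?\<rho>1 ?\<rho>2 = H \<pi>1 \<pi>2 + box_support l u S X Y"
        unfolding H_def box_support_def sum.distrib[symmetric]
      proof (rule sum.cong)
        fix v assume "v \<in> S"
        note d = square_conj_diff[OF c_pos[OF this]]
        show "square_conj (c v) (?\<rho>1 v + ?\<rho>2 v) = square_conj (c v) (\<pi>1 v + \<pi>2 v) +
          (if v \<in> X \<and> v \<notin> Y then u v else if v \<in> Y \<and> v \<notin> X then - l v else 0)"
          using d[of "\<pi>1 v + \<pi>2 v"] d[of "\<pi>1 v + \<pi>2 v - 1"]
          by (auto simp: l_def u_def algebra_simps)
      qed simp
      thus ?thesis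
        using opt[of ?\<rho>1 ?\<rho>2] unfolding dual_H q p_def n_def
        by (cases "A.P ?\<rho>1"; cases "B.P ?\<rho>2") auto
    qed
  qed
  then obtain x :: "'a \<Rightarrow> int" where box: "\<And>v. v \<in> S \<Longrightarrow> l v \<le> x v \<and> x v \<le> u v"
    and px: "\<And>X. X \<subseteq> S \<Longrightarrow> p X \<le> ereal (of_int (sum x X))"
    and nx: "\<And>X. X \<subseteq> S \<Longrightarrow> n X \<le> ereal (of_int (- sum x X))"
    by blast
  have A_loc: "A.P (\<lambda>v. \<pi>1 v + of_bool (v \<in> X)) \<le> ereal (of_int (q1 + sum x X))" if "X \<subseteq> S" for X
    using px[OF that] unfolding p_def by (cases "A.P (\<lambda>v. \<pi>1 v + of_bool (v \<in> X))") auto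
  have B_loc': "B.P (\<lambda>v. \<pi>2 v - of_bool (v \<in> X)) \<le> ereal (of_int (q2 - sum x X))" if "X \<subseteq> S" for X
    using nx[OF that] unfolding n_def by (cases "B.P (\<lambda>v. \<pi>2 v - of_bool (v \<in> X))") auto
  \<comment> \<open>The separation inequalities at \<open>X = S\<close> give
    \<open>A.total \<le> sum x S \<le> B.total\<close>. Optimality against the opposite constant
    shifts of \<open>\<pi>1\<close> and \<open>\<pi>2\<close>, which keep their sum, closes the
    chain.\<close>
  have "A.P (\<lambda>v. \<pi>1 v + 1) = A.P (\<lambda>v. \<pi>1 v + of_bool (v \<in> S))" by (rule A.P_cong) simp
  hence "ereal (of_int (q1 + A.total)) \<le> ereal (of_int (q1 + sum x S))"
    using A_loc[of S] by (simp add: A.P_shift q1)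
  hence "A.total \<le> sum x S" unfolding ereal_less_eq of_int_le_iff by simp
  moreover have "B.P (\<lambda>v. \<pi>2 v + - 1) = B.P (\<lambda>v. \<pi>2 v - of_bool (v \<in> S))" by (rule B.P_cong) simp
  hence "ereal (of_int (q2 - B.total)) \<le> ereal (of_int (q2 - sum x S))"
    using B_loc'[of S] unfolding B.P_shift q2 by simp
  hence "sum x S \<le> B.total" unfolding ereal_less_eq of_int_le_iff by simp
  moreover have "B.total \<le> A.total"
  proof -
    have "H (\<lambda>v. \<pi>1 v + - 1) (\<lambda>v. \<pi>2 v + 1) = H \<pi>1 \<pi>2" by (simp add: H_def)
    thus ?thesis using opt[of "\<lambda>v. \<pi>1 v + - 1" "\<lambda>v. \<pi>2 v + 1"]
      unfolding dual_H A.P_shift B.P_shift q1 q2 q by simp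
  qed
  ultimately have totals: "sum x S = A.total" "sum x S = B.total" by auto
  have A_loc2: "A.P (\<lambda>v. \<pi>1 v + of_bool (v \<in> X)) \<le> A.P \<pi>1 + ereal (of_int (sum x X))" if "X \<subseteq> S" for X
    using A_loc[OF that] by (simp add: q1)
  \<comment> \<open>Adding the indicator of \<open>X\<close> amounts to subtracting that of
    \<open>S - X\<close> and translating by 1, so the downward inequalities yield the upward
    ones.\<close>
  have B_loc: "B.P (\<lambda>v. \<pi>2 v + of_bool (v \<in> X)) \<le> B.P \<pi>2 + ereal (of_int (sum x X))" if X: "X \<subseteq> S" for X
  proof -
    have "sum x S = sum x X + sum x (S - X)" using X by (simp add: sum.subset_diff)
    hence eq: "q2 - sum x (S - X) + 1 * B.total = q2 + sum x X" using totals by simp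
    have "B.P (\<lambda>v. \<pi>2 v + of_bool (v \<in> X)) = B.P (\<lambda>v. (\<pi>2 v - of_bool (v \<in> S - X)) + 1)"
      by (rule B.P_cong) simp
    also have "\<dots> = B.P (\<lambda>v. \<pi>2 v - of_bool (v \<in> S - X)) + ereal (of_int (1 * B.total))"
      by (rule B.P_shift)
    also have "\<dots> \<le> ereal (of_int (q2 - sum x (S - X))) + ereal (of_int (1 * B.total))"
      by (intro add_right_mono B_loc') auto
    also have "\<dots> = ereal (of_int (q2 + sum x X))" unfolding eq[symmetric] by simp
    finally show ?thesis by (simp add: q2)
  qed
  note A_fin = A.supergradient_in_base[OF q1 totals(1) A_loc2]
  note B_fin = B.supergradient_in_base[OF q2 totals(2) B_loc]
  \<comment> \<open>The box places each \<open>x v\<close> between the two slopes of the conjugate,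
    so the Fenchel inequality is tight.\<close>
  have "(\<Sum>v\<in>S. c v * (x v)\<^sup>2) = (\<Sum>v\<in>S. \<pi>1 v * x v + \<pi>2 v * x v - square_conj (c v) (\<pi>1 v + \<pi>2 v))"
  proof (rule sum.cong)
    fix v assume v: "v \<in> S"
    have "square_conj (c v) (\<pi>1 v + \<pi>2 v) = x v * (\<pi>1 v + \<pi>2 v) - c v * (x v)\<^sup>2"
      using box[OF v] c_pos[OF v] by (intro square_conj_eq) (auto simp: l_def u_def)
    thus "c v * (x v)\<^sup>2 = \<pi>1 v * x v + \<pi>2 v * x v - square_conj (c v) (\<pi>1 v + \<pi>2 v)"
      by (simp add: algebra_simps)
  qed simp
  also have "\<dots> = (\<Sum>v\<in>S. \<pi>1 v * x v) + (\<Sum>v\<in>S. \<pi>2 v * x v) - H \<pi>1 \<pi>2"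
    by (simp add: H_def sum.distrib sum_subtractf)
  also have "\<dots> \<le> q" using A_fin(2) B_fin(2) q by simp
  finally have "ereal (of_int (\<Sum>v\<in>S. c v * (x v)\<^sup>2)) \<le> dual \<pi>1 \<pi>2"
    unfolding dq by (simp del: of_int_sum)
  with A_fin(1) B_fin(1) that show thesis by blast
qed

end

section \<open>Transfer to real-valued integral vectors\<close>

lemma square_conj_floor:
  fixes a c :: int
  assumes "c \<ge> 1"
  shows "of_int \<lfloor>1/2 * (of_int a / of_int c + 1 :: real)\<rfloor> *
      (of_int a - of_int c * of_int \<lfloor>1/2 * (of_int a / of_int c + 1 :: real)\<rfloor>) = real_of_int (square_conj c a)"
proof -
  have "1/2 * (of_int a / of_int c + 1 :: real) = of_int (a + c) / of_int (2 * c)"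
    using assms by (simp add: field_simps)
  hence "\<lfloor>1/2 * (of_int a / of_int c + 1 :: real)\<rfloor> = conj_arg c a"
    unfolding conj_arg_def by (simp only: floor_divide_of_int_eq)
  thus ?thesis by (simp add: square_conj_def)
qed

text \<open>The second conjunct is what turns the infimum into a minimum when it is taken over a
  nonempty set.\<close>

theorem theorem7p13:
  fixes S :: "'a set" and p\<^sub>1 p\<^sub>2 :: "'a set \<Rightarrow> ereal" and c :: "'a \<Rightarrow> real"
  assumes "finite S" and "S \<noteq> {}"
    and "int_supermodular S p\<^sub>1" and "base_polyhedron S p\<^sub>1 \<noteq> {}"
    and "int_supermodular S p\<^sub>2" and "base_polyhedron S p\<^sub>2 \<noteq> {}"
    and "c \<in> int_vecs S" and "\<forall>s\<in>S. c s \<ge> 1"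
  shows "(INF x \<in> int_base_points S p\<^sub>1 \<inter> int_base_points S p\<^sub>2. ereal (\<Sum>s\<in>S. c s * (x s)\<^sup>2)) =
         Sup {lin_ext S p\<^sub>1 \<pi>\<^sub>1 + lin_ext S p\<^sub>2 \<pi>\<^sub>2 -
                ereal (\<Sum>s\<in>S. of_int \<lfloor>1/2 * (\<pi> s / c s + 1)\<rfloor> *
                              (\<pi> s - c s * of_int \<lfloor>1/2 * (\<pi> s / c s + 1)\<rfloor>))
              | \<pi> \<pi>\<^sub>1 \<pi>\<^sub>2. \<pi>\<^sub>1 \<in> int_vecs S \<and> \<pi>\<^sub>2 \<in> int_vecs S \<and> (\<forall>s\<in>S. \<pi> s = \<pi>\<^sub>1 s + \<pi>\<^sub>2 s)}
       \<and> (int_base_points S p\<^sub>1 \<inter> int_base_points S p\<^sub>2 \<noteq> {} \<longrightarrow>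
           (\<exists>x \<in> int_base_points S p\<^sub>1 \<inter> int_base_points S p\<^sub>2.
            \<forall>y \<in> int_base_points S p\<^sub>1 \<inter> int_base_points S p\<^sub>2.
              (\<Sum>s\<in>S. c s * (x s)\<^sup>2) \<le> (\<Sum>s\<in>S. c s * (y s)\<^sup>2)))"
    (is "?inf = Sup ?D \<and> _")
proof -
  define c' where "c' v = \<lfloor>c v\<rfloor>" for v
  have of_int_floor: "of_int \<lfloor>x v\<rfloor> = x v" if "x \<in> int_vecs S" "v \<in> S" for x :: "'a \<Rightarrow> real" and v
    using that by (auto simp: int_vecs_def PiE_def Pi_def)
  have c': "c v = of_int (c' v)" if "v \<in> S" for v
    unfolding c'_def by (rule of_int_floor[OF assms(7) that, symmetric])
  interpret two_bases S p\<^sub>1 p\<^sub>2 c'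
    by unfold_locales (use assms c' in auto)
  let ?X = "int_base_points S p\<^sub>1 \<inter> int_base_points S p\<^sub>2"
  let ?val = "\<lambda>x :: 'a \<Rightarrow> real. \<Sum>s\<in>S. c s * (x s)\<^sup>2"
  have term_eq: "of_int \<lfloor>1/2 * (\<pi> s / c s + 1)\<rfloor> * (\<pi> s - c s * of_int \<lfloor>1/2 * (\<pi> s / c s + 1)\<rfloor>) =
      real_of_int (square_conj (c' s) a)" if "s \<in> S" "\<pi> s = of_int a" for \<pi> s a
    unfolding that(2) c'[OF that(1)] by (rule square_conj_floor[OF c_pos[OF that(1)]])
  \<comment> \<open>Floors take integral real vectors to integer functions, and restriction to
    \<open>S\<close> takes them back; \<open>lin_ext_cong\<close> absorbs the values outside
    \<open>S\<close>.\<close>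
  have D: "?D = {dual \<rho>1 \<rho>2 | \<rho>1 \<rho>2. True}"
  proof (intro equalityI subsetI)
    fix z assume "z \<in> ?D"
    then obtain \<pi> \<pi>\<^sub>1 \<pi>\<^sub>2 where z: "z = lin_ext S p\<^sub>1 \<pi>\<^sub>1 + lin_ext S p\<^sub>2 \<pi>\<^sub>2 -
        ereal (\<Sum>s\<in>S. of_int \<lfloor>1/2 * (\<pi> s / c s + 1)\<rfloor> * (\<pi> s - c s * of_int \<lfloor>1/2 * (\<pi> s / c s + 1)\<rfloor>))"
      and \<pi>: "\<pi>\<^sub>1 \<in> int_vecs S" "\<pi>\<^sub>2 \<in> int_vecs S" "\<forall>s\<in>S. \<pi> s = \<pi>\<^sub>1 s + \<pi>\<^sub>2 s"
      by blast
    have "z = dual (\<lambda>v. \<lfloor>\<pi>\<^sub>1 v\<rfloor>) (\<lambda>v. \<lfloor>\<pi>\<^sub>2 v\<rfloor>)"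
      unfolding z dual_def A.P_def B.P_def of_int_sum
    proof (intro arg_cong2[of _ _ _ _ "(-)"] arg_cong2[of _ _ _ _ "(+)"] arg_cong[of _ _ ereal]
        lin_ext_cong sum.cong term_eq refl A.fin assms(2))
      show *: "\<pi>\<^sub>1 v = of_int \<lfloor>\<pi>\<^sub>1 v\<rfloor>" "\<pi>\<^sub>2 v = of_int \<lfloor>\<pi>\<^sub>2 v\<rfloor>" if "v \<in> S" for v
        by (rule of_int_floor[OF \<pi>(1) that, symmetric], rule of_int_floor[OF \<pi>(2) that, symmetric])
      show "\<pi> v = of_int (\<lfloor>\<pi>\<^sub>1 v\<rfloor> + \<lfloor>\<pi>\<^sub>2 v\<rfloor>)" if "v \<in> S" for v
        using *[OF that] \<pi>(3) that by (simp del: of_int_floor_cancel)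
    qed
    thus "z \<in> {dual \<rho>1 \<rho>2 | \<rho>1 \<rho>2. True}" by blast
  next
    fix z assume "z \<in> {dual \<rho>1 \<rho>2 | \<rho>1 \<rho>2. True}"
    then obtain \<rho>1 \<rho>2 where z: "z = dual \<rho>1 \<rho>2" by blast
    define \<pi>\<^sub>1 \<pi>\<^sub>2 where "\<pi>\<^sub>1 = (\<lambda>v\<in>S. real_of_int (\<rho>1 v))" and "\<pi>\<^sub>2 = (\<lambda>v\<in>S. real_of_int (\<rho>2 v))"
    have "\<pi>\<^sub>1 \<in> int_vecs S" "\<pi>\<^sub>2 \<in> int_vecs S"
      by (auto simp: \<pi>\<^sub>1_def \<pi>\<^sub>2_def int_vecs_def)
    moreover have "z = lin_ext S p\<^sub>1 \<pi>\<^sub>1 + lin_ext S p\<^sub>2 \<pi>\<^sub>2 -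
        ereal (\<Sum>s\<in>S. of_int \<lfloor>1/2 * ((\<pi>\<^sub>1 s + \<pi>\<^sub>2 s) / c s + 1)\<rfloor> *
          ((\<pi>\<^sub>1 s + \<pi>\<^sub>2 s) - c s * of_int \<lfloor>1/2 * ((\<pi>\<^sub>1 s + \<pi>\<^sub>2 s) / c s + 1)\<rfloor>))"
      unfolding z dual_def A.P_def B.P_def of_int_sum
      by (intro arg_cong2[of _ _ _ _ "(-)"] arg_cong2[of _ _ _ _ "(+)"] arg_cong[of _ _ ereal]
        lin_ext_cong sum.cong term_eq[symmetric] refl A.fin assms(2))
        (auto simp: \<pi>\<^sub>1_def \<pi>\<^sub>2_def)
    ultimately show "z \<in> ?D"
      by (intro CollectI exI[of _ "\<lambda>s. \<pi>\<^sub>1 s + \<pi>\<^sub>2 s"] exI[of _ \<pi>\<^sub>1] exI[of _ \<pi>\<^sub>2] conjI ballI refl)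
  qed
  have val: "?val (\<lambda>v\<in>S. real_of_int (x v)) = of_int (\<Sum>v\<in>S. c' v * (x v)\<^sup>2)" for x
    unfolding of_int_sum by (intro sum.cong) (auto simp: c')
  have points: "\<exists>x :: 'a \<Rightarrow> int. y = (\<lambda>v\<in>S. real_of_int (x v))" if "y \<in> ?X" for y
  proof -
    have y: "y \<in> int_vecs S" using that by (auto simp: int_base_points_def)
    have "y = (\<lambda>v\<in>S. real_of_int \<lfloor>y v\<rfloor>)"
    proof (rule ext)
      fix v
      show "y v = (\<lambda>v\<in>S. real_of_int \<lfloor>y v\<rfloor>) v"
      proof (cases "v \<in> S")
        case True
        thus ?thesis using of_int_floor[OF y True, symmetric] by simp
      next
        case False
        thus ?thesis using y by (auto simp: int_vecs_def)
      qed
    qed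
    thus ?thesis by (rule exI[of _ "\<lambda>v. \<lfloor>y v\<rfloor>"])
  qed
  have weak: "dual \<rho>1 \<rho>2 \<le> ereal (?val y)" if y: "y \<in> ?X" for \<rho>1 \<rho>2 y
  proof -
    obtain x :: "'a \<Rightarrow> int" where x: "y = (\<lambda>v\<in>S. real_of_int (x v))" using points[OF y] by blast
    show ?thesis using y unfolding x val int_base_points_def by (intro weak_duality) auto
  qed
  show ?thesis
  proof (cases "\<exists>K. \<forall>\<rho>1 \<rho>2. dual \<rho>1 \<rho>2 \<le> ereal (of_int K)")
    case True
    then obtain x \<rho>1 \<rho>2 where x: "(\<lambda>v\<in>S. real_of_int (x v)) \<in> base_polyhedron S p\<^sub>1"
      "(\<lambda>v\<in>S. real_of_int (x v)) \<in> base_polyhedron S p\<^sub>2"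
      and "ereal (of_int (\<Sum>v\<in>S. c' v * (x v)\<^sup>2)) \<le> dual \<rho>1 \<rho>2"
      using strong_duality by metis
    define y where "y = (\<lambda>v\<in>S. real_of_int (x v))"
    have y: "y \<in> ?X" using x by (auto simp: y_def int_base_points_def int_vecs_def)
    have le: "ereal (?val y) \<le> dual \<rho>1 \<rho>2"
      unfolding y_def val by fact
    have "?inf \<le> ereal (?val y)" using y by (rule INF_lower)
    also have "\<dots> \<le> Sup ?D" using le unfolding D by (rule order_trans) (auto intro: Sup_upper)
    finally have "?inf \<le> Sup ?D" .
    moreover have "Sup ?D \<le> ?inf"
      unfolding D by (rule Sup_least) (auto intro!: INF_greatest weak)
    moreover have "?val y \<le> ?val z" if "z \<in> ?X" for z
      using order_trans[OF le weak[OF that]] by simp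
    ultimately show ?thesis using y by (auto intro: antisym)
  next
    case False
    have "?X = {}"
    proof (rule ccontr)
      assume "?X \<noteq> {}"
      then obtain y where y: "y \<in> ?X" by blast
      then obtain x :: "'a \<Rightarrow> int" where "y = (\<lambda>v\<in>S. real_of_int (x v))" using points by blast
      with False weak[OF y] show False using val by metis
    qed
    moreover have "Sup ?D = \<infinity>"
    proof (rule ccontr)
      assume "Sup ?D \<noteq> \<infinity>"
      \<comment> \<open>Rounding up gives an integer bound. If the supremum were
        \<open>-\<infinity>\<close>, \<open>real_of_ereal\<close> would return 0, which is also a
        bound.\<close>
      have "Sup ?D \<le> ereal (of_int \<lceil>real_of_ereal (Sup ?D)\<rceil>)"
        using \<open>Sup ?D \<noteq> \<infinity>\<close> by (cases "Sup ?D") auto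
      moreover have "dual \<rho>1 \<rho>2 \<le> Sup ?D" for \<rho>1 \<rho>2 unfolding D by (rule Sup_upper) blast
      ultimately have "dual \<rho>1 \<rho>2 \<le> ereal (of_int \<lceil>real_of_ereal (Sup ?D)\<rceil>)" for \<rho>1 \<rho>2
        by (rule order_trans[rotated])
      with False show False by blast
    qed
    ultimately show ?thesis by (simp add: top_ereal_def)
  qed
qed

end
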